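(* Let $N\ge 1$, $0<\tau<\beta$, $s\ge 1$, and let $u_0,u_1,u_2\in L^1(\mathbb{R}^N)\cap H^s(\mathbb{R}^N)$. Let $u$ be the solution of $$\tau u_{ttt}+u_{tt}-\Delta u-\beta\Delta u_t=0\quad\text{in }\mathbb{R}^N,\ t>0,$$ with $u(\cdot,0)=u_0$, $u_t(\cdot,0)=u_1$, $u_{tt}(\cdot,0)=u_2$. Fix $\nu_1>0$ sufficiently small (depending only on $\tau,\beta$) and set $$c=\min\left\{\frac1\beta,\ \frac{\beta-\tau}{2\beta\tau},\ |\operatorname{Re}\lambda_{2,3}(\nu_1)|\right\}>0.$$ Then there is a constant $C>0$, independent of $t$ and of the initial data, such that for all integers $0\le j\le s$ and all $t\ge 0$, $$\|\partial_x^ju(t)\|_{L^2}\le C\big(\|u_0\|_{L^1}+\|u_1\|_{L^1}+\|u_2\|_{L^1}\big)(1+t)^{1-N/4-j/2}+C\big(\|\partial_x^ju_0\|_{L^2}+\|\partial_x^ju_1\|_{L^2}+\|\partial_x^ju_2\|_{L^2}\big)e^{-ct}.$$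
   Context: All norms are over $\mathbb{R}^N$. $\hat f(\xi)$ denotes the Fourier transform in $x\in\mathbb{R}^N$. $\partial_x^j$ stands for the spatial derivatives of order $j$, with (Plancherel) $\|\partial_x^jf\|_{L^2}^2=\int_{\mathbb{R}^N}|\xi|^{2j}|\hat f(\xi)|^2\,d\xi$. The solution $u$ is the one whose spatial Fourier transform solves, for each frequency $\xi$, the ODE $\tau\hat u_{ttt}+\hat u_{tt}+|\xi|^2\hat u+\beta|\xi|^2\hat u_t=0$ with $\hat u(\xi,0)=\hat u_0(\xi)$, $\hat u_t(\xi,0)=\hat u_1(\xi)$, $\hat u_{tt}(\xi,0)=\hat u_2(\xi)$. For $r=|\xi|$, the eigenvalues are the roots of $\tau\lambda^3+\lambda^2+\beta r^2\lambda+r^2=0$. For sufficiently small $r>0$ there are one real root and two nonreal complex conjugate roots; $\lambda_{2,3}(r)$ denotes this nonreal conjugate pair, whose real part is negative. *)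

theory Defs
  imports "HOL-Analysis.Analysis"
begin

text \<open>
  The dimension \<open>N\<close> is a natural number and not an index type, because the smallness of
  \<open>\<nu>\<^sub>1\<close> must not depend on it.  The space \<open>\<real>\<^sup>N\<close> is therefore represented by the functions in
  \<open>{..<N} \<rightarrow>\<^sub>E UNIV\<close> with the product measure, and the Euclidean norm of \<open>x\<close> is
  \<open>L2_set x {..<N}\<close>.  Functions on \<open>\<real>\<^sup>N\<close> are complex-valued Borel representatives of their
  almost-everywhere classes.
\<close>

definition leb :: "nat \<Rightarrow> (nat \<Rightarrow> real) measure" where
  "leb N = (\<Pi>\<^sub>M i\<in>{..<N}. lborel)"

definition L1_norm :: "nat \<Rightarrow> ((nat \<Rightarrow> real) \<Rightarrow> complex) \<Rightarrow> real" where
  "L1_norm N f = (\<integral>x. cmod (f x) \<partial>leb N)"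

definition square_integrable :: "nat \<Rightarrow> ((nat \<Rightarrow> real) \<Rightarrow> complex) \<Rightarrow> bool" where
  "square_integrable N f \<longleftrightarrow>
     f \<in> borel_measurable (leb N) \<and> integrable (leb N) (\<lambda>x. (cmod (f x))\<^sup>2)"

text \<open>
  The normalisation is the unitary one, for which Plancherel's identity has no constant and
  \<open>-\<Delta>\<close> has symbol \<open>|\<xi>|\<^sup>2\<close>.  The integral is meaningful for integrable \<open>f\<close>.
\<close>

definition fourier_integral ::
    "nat \<Rightarrow> ((nat \<Rightarrow> real) \<Rightarrow> complex) \<Rightarrow> (nat \<Rightarrow> real) \<Rightarrow> complex" where
  "fourier_integral N f \<xi> =
     complex_of_real ((2 * pi) powr (- real N / 2)) *
       (\<integral>x. cis (- (\<Sum>i<N. x i * \<xi> i)) * f x \<partial>leb N)"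

text \<open>
  The Fourier transform on \<open>L\<^sup>2\<close>: the limit in \<open>L\<^sup>2\<close> of the Fourier integrals of the
  truncations of \<open>f\<close> to balls.  It determines \<open>F\<close> up to a null set, and for
  \<open>f \<in> L\<^sup>1 \<inter> L\<^sup>2\<close> it agrees almost everywhere with \<open>fourier_integral N f\<close>.
\<close>

definition has_L2_fourier ::
    "nat \<Rightarrow> ((nat \<Rightarrow> real) \<Rightarrow> complex) \<Rightarrow> ((nat \<Rightarrow> real) \<Rightarrow> complex) \<Rightarrow> bool" where
  "has_L2_fourier N f F \<longleftrightarrow>
     square_integrable N f \<and> square_integrable N F \<and>
     ((\<lambda>R::real. \<integral>\<^sup>+\<xi>. ennreal ((cmod (F \<xi> -
          fourier_integral N (\<lambda>x. if L2_set x {..<N} < R then f x else 0) \<xi>))\<^sup>2) \<partial>leb N)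
        \<longlongrightarrow> 0) at_top"

definition L2_fourier ::
    "nat \<Rightarrow> ((nat \<Rightarrow> real) \<Rightarrow> complex) \<Rightarrow> (nat \<Rightarrow> real) \<Rightarrow> complex" where
  "L2_fourier N f = (SOME F. has_L2_fourier N f F)"

definition in_Sobolev :: "nat \<Rightarrow> real \<Rightarrow> ((nat \<Rightarrow> real) \<Rightarrow> complex) \<Rightarrow> bool" where
  "in_Sobolev N s f \<longleftrightarrow>
     (\<exists>F. has_L2_fourier N f F \<and>
        integrable (leb N) (\<lambda>\<xi>. (1 + (L2_set \<xi> {..<N})\<^sup>2) powr s * (cmod (F \<xi>))\<^sup>2))"

text \<open>
  The norm \<open>\<parallel>\<partial>\<^sub>x\<^sup>j f\<parallel>\<close> in \<open>L\<^sup>2\<close>, given on the Fourier side.  The Bochner integral in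
  \<open>deriv_norm\<close> is \<open>0\<close> for a non-integrable integrand, so finiteness is a separate predicate.
\<close>

definition deriv_in_L2 :: "nat \<Rightarrow> nat \<Rightarrow> ((nat \<Rightarrow> real) \<Rightarrow> complex) \<Rightarrow> bool" where
  "deriv_in_L2 N j f \<longleftrightarrow>
     integrable (leb N) (\<lambda>\<xi>. (L2_set \<xi> {..<N}) ^ (2 * j) * (cmod (L2_fourier N f \<xi>))\<^sup>2)"

definition deriv_norm :: "nat \<Rightarrow> nat \<Rightarrow> ((nat \<Rightarrow> real) \<Rightarrow> complex) \<Rightarrow> real" where
  "deriv_norm N j f =
     sqrt (\<integral>\<xi>. (L2_set \<xi> {..<N}) ^ (2 * j) * (cmod (L2_fourier N f \<xi>))\<^sup>2 \<partial>leb N)"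

text \<open>
  In \<open>is_solution\<close>, \<open>U t\<close> is the representative of the Fourier transform of \<open>u t\<close> that solves
  the equation at every frequency; \<open>V\<close>, \<open>W\<close>, \<open>Z\<close> are its first three time derivatives
  (one-sided at \<open>t = 0\<close>).  The data are integrable where this is used, so their transforms
  are defined at every frequency.
\<close>

definition is_solution ::
    "nat \<Rightarrow> real \<Rightarrow> real \<Rightarrow> ((nat \<Rightarrow> real) \<Rightarrow> complex) \<Rightarrow> ((nat \<Rightarrow> real) \<Rightarrow> complex) \<Rightarrow>
     ((nat \<Rightarrow> real) \<Rightarrow> complex) \<Rightarrow> (real \<Rightarrow> (nat \<Rightarrow> real) \<Rightarrow> complex) \<Rightarrow> bool" where
  "is_solution N \<tau> \<beta> u0 u1 u2 u \<longleftrightarrow>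
     (\<exists>U. (\<forall>t\<ge>0. has_L2_fourier N (u t) (U t)) \<and>
        (\<forall>\<xi>\<in>space (leb N). \<exists>V W Z.
           (\<forall>t\<ge>0.
              ((\<lambda>t. U t \<xi>) has_vector_derivative V t) (at t within {0..}) \<and>
              (V has_vector_derivative W t) (at t within {0..}) \<and>
              (W has_vector_derivative Z t) (at t within {0..}) \<and>
              complex_of_real \<tau> * Z t + W t
                + complex_of_real ((L2_set \<xi> {..<N})\<^sup>2) * U t \<xi>
                + complex_of_real (\<beta> * (L2_set \<xi> {..<N})\<^sup>2) * V t = 0) \<and>
           U 0 \<xi> = fourier_integral N u0 \<xi> \<and>
           V 0 = fourier_integral N u1 \<xi> \<and>
           W 0 = fourier_integral N u2 \<xi>))"

definition is_eigenvalue :: "real \<Rightarrow> real \<Rightarrow> real \<Rightarrow> complex \<Rightarrow> bool" where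
  "is_eigenvalue \<tau> \<beta> r z \<longleftrightarrow>
     complex_of_real \<tau> * z ^ 3 + z\<^sup>2 + complex_of_real (\<beta> * r\<^sup>2) * z + complex_of_real (r\<^sup>2) = 0"

text \<open>
  The nonreal conjugate pair is \<open>lambda2\<close>, \<open>cnj lambda2\<close>; both have the same real part.
  See \<open>lambda2_well_defined\<close> below.
\<close>

definition lambda2 :: "real \<Rightarrow> real \<Rightarrow> real \<Rightarrow> complex" where
  "lambda2 \<tau> \<beta> r = (THE z. is_eigenvalue \<tau> \<beta> r z \<and> Im z > 0)"

lemma lambda2_well_defined:
  fixes \<tau> \<beta> r :: real
  assumes "0 < \<tau>" "\<tau> < \<beta>" "0 < r" "r < 2 * \<tau>\<^sup>2 / \<beta> ^ 3"
  shows "\<exists>!z. is_eigenvalue \<tau> \<beta> r z \<and> Im z > 0"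
    and "Re (lambda2 \<tau> \<beta> r) < 0"
proof -
  have b: "0 < \<beta>" using assms by simp
  let ?p = "\<lambda>x::real. \<tau> * x ^ 3 + x\<^sup>2 + \<beta> * r\<^sup>2 * x + r\<^sup>2"
  have lo: "?p (- 1 / \<tau>) \<le> 0"
  proof -
    have "?p (- 1 / \<tau>) = r\<^sup>2 * (1 - \<beta> / \<tau>)"
      using assms(1) by (simp add: field_simps power2_eq_square power3_eq_cube)
    then show ?thesis using assms by (simp add: mult_le_0_iff)
  qed
  have hi: "0 \<le> ?p (- 1 / \<beta>)"
  proof -
    have "?p (- 1 / \<beta>) = (\<beta> - \<tau>) / \<beta> ^ 3"
      using b by (simp add: field_simps power2_eq_square power3_eq_cube)
    then show ?thesis using assms b by simp
  qed
  have "- 1 / \<tau> \<le> - 1 / \<beta>" using assms b by (simp add: field_simps)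
  moreover have cont: "continuous_on {- 1 / \<tau>..- 1 / \<beta>} ?p"
    by (intro continuous_intros)
  ultimately obtain a where a: "- 1 / \<tau> \<le> a" "a \<le> - 1 / \<beta>" "?p a = 0"
    using IVT'[of ?p "- 1 / \<tau>" 0 "- 1 / \<beta>", OF lo hi]
    by (metis (no_types, lifting) cont)
  have an: "a < 0" using a(2) b by (smt (verit) divide_neg_pos)
  have ne: "a \<noteq> - 1 / \<tau>"
  proof
    assume "a = - 1 / \<tau>"
    with a(3) have "r\<^sup>2 * (1 - \<beta> / \<tau>) = 0"
      using assms(1) by (simp add: field_simps power2_eq_square power3_eq_cube)
    then show False using assms by (simp add: field_simps)
  qed
  define q where "q = 1 + \<tau> * a"
  define m where "m = - r\<^sup>2 / a"
  have q0: "0 < q" using a(1) ne assms(1) by (simp add: q_def field_simps)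
  have am: "a * m = - r\<^sup>2" using an by (simp add: m_def)
  have aq: "a * q + \<beta> * r\<^sup>2 = m"
  proof -
    have "a * (a * q + \<beta> * r\<^sup>2) = a * m"
      using a(3) am by (simp add: q_def algebra_simps power2_eq_square power3_eq_cube)
    then show ?thesis using an by simp
  qed
  have qub: "q \<le> r\<^sup>2 * \<beta> ^ 3 / \<tau>"
  proof -
    have "1 / \<beta> \<le> - a" using a(2) by simp
    then have "(1 / \<beta>)\<^sup>2 \<le> a\<^sup>2"
      using b power_mono[of "1 / \<beta>" "- a" 2] by simp
    then have "q * (1 / \<beta>)\<^sup>2 \<le> q * a\<^sup>2" using q0 by simp
    also have "q * a\<^sup>2 = r\<^sup>2 * (- \<beta> * a - 1)"
      using a(3) by (simp add: q_def algebra_simps power2_eq_square power3_eq_cube)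
    also have "\<dots> \<le> r\<^sup>2 * (\<beta> / \<tau>)"
    proof (rule mult_left_mono)
      have "\<beta> * (- a) \<le> \<beta> * (1 / \<tau>)" using a(1) b by (intro mult_left_mono) auto
      then show "- \<beta> * a - 1 \<le> \<beta> / \<tau>" by simp
    qed simp
    finally show ?thesis using b assms(1)
      by (simp add: field_simps power2_eq_square power3_eq_cube)
  qed
  have disc: "q\<^sup>2 < 4 * \<tau> * m"
  proof -
    have "r * \<beta> ^ 3 < 2 * \<tau>\<^sup>2" using assms(4) b by (simp add: field_simps)
    then have "r * (r * \<beta> ^ 3) / \<tau> < r * (2 * \<tau>\<^sup>2) / \<tau>"
      using assms(1,3) by (intro divide_strict_right_mono mult_strict_left_mono) auto
    then have "q < 2 * \<tau> * r"
      using qub assms(1) by (simp add: power2_eq_square mult_ac)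
    then have "q\<^sup>2 < (2 * \<tau> * r)\<^sup>2" using q0 by (intro power_strict_mono) auto
    also have "\<dots> \<le> 4 * \<tau> * m"
    proof -
      have "- a \<le> 1 / \<tau>" using a(1) by simp
      then have "\<tau> * (- a) \<le> 1" using assms(1) by (simp add: field_simps)
      then have "\<tau> * r\<^sup>2 * (- a) \<le> r\<^sup>2"
        using mult_left_mono[of "\<tau> * (- a)" 1 "r\<^sup>2"] by (simp add: mult_ac)
      then have "\<tau> * r\<^sup>2 \<le> m" using an by (simp add: m_def field_simps)
      then show ?thesis using assms(1) by (simp add: power2_eq_square mult_ac)
    qed
    finally show ?thesis .
  qed
  have fac: "is_eigenvalue \<tau> \<beta> r z \<longleftrightarrow>
      z = of_real a \<or> of_real \<tau> * z\<^sup>2 + of_real q * z + of_real m = 0" for z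
  proof -
    have "of_real \<tau> * z ^ 3 + z\<^sup>2 + of_real (\<beta> * r\<^sup>2) * z + of_real (r\<^sup>2) =
        (z - of_real a) * (of_real \<tau> * z\<^sup>2 + of_real q * z + of_real m)"
    proof -
      have 1: "of_real (\<beta> * r\<^sup>2) = (of_real m - of_real a * of_real q :: complex)"
        using aq by (metis add_diff_cancel_left' of_real_diff of_real_mult)
      have 2: "of_real (r\<^sup>2) = (- (of_real a * of_real m) :: complex)"
        using am by (metis minus_minus of_real_minus of_real_mult)
      have 3: "(of_real q :: complex) = 1 + of_real \<tau> * of_real a"
        by (simp add: q_def)
      show ?thesis unfolding 1 2 unfolding 3
        by (simp add: algebra_simps power2_eq_square power3_eq_cube)
    qed
    then show ?thesis by (simp add: is_eigenvalue_def)
  qed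
  define d where "d = sqrt (4 * \<tau> * m - q\<^sup>2)"
  have d: "0 < d" "d\<^sup>2 = 4 * \<tau> * m - q\<^sup>2" using disc by (auto simp: d_def)
  have iff: "is_eigenvalue \<tau> \<beta> r z \<and> Im z > 0 \<longleftrightarrow> z = Complex (- q / (2 * \<tau>)) (d / (2 * \<tau>))"
    for z
  proof
    assume z: "is_eigenvalue \<tau> \<beta> r z \<and> Im z > 0"
    then have e: "of_real \<tau> * z\<^sup>2 + of_real q * z + of_real m = 0" using fac by auto
    have im: "2 * \<tau> * Re z * Im z + q * Im z = 0"
      using arg_cong[OF e, of Im] by (simp add: power2_eq_square algebra_simps)
    have re: "\<tau> * ((Re z)\<^sup>2 - (Im z)\<^sup>2) + q * Re z + m = 0"
      using arg_cong[OF e, of Re] by (simp add: power2_eq_square algebra_simps)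
    have "(2 * \<tau> * Re z + q) * Im z = 0" using im by (simp add: algebra_simps)
    then have q: "q = - (2 * \<tau> * Re z)" using z by simp
    have "(2 * \<tau> * Im z)\<^sup>2 = d\<^sup>2"
      unfolding d(2) using re unfolding q by algebra
    then have "2 * \<tau> * Im z = d" using z d(1) assms(1) by (simp add: power2_eq_iff_nonneg)
    then show "z = Complex (- q / (2 * \<tau>)) (d / (2 * \<tau>))"
      using q assms(1) by (auto simp: complex_eq_iff field_simps)
  next
    assume z: "z = Complex (- q / (2 * \<tau>)) (d / (2 * \<tau>))"
    define x y where "x = - q / (2 * \<tau>)" and "y = d / (2 * \<tau>)"
    have qx: "q = - 2 * \<tau> * x" and dy: "d = 2 * \<tau> * y"
      using assms(1) by (simp_all add: x_def y_def)
    have "4 * \<tau> * (\<tau> * (x\<^sup>2 + y\<^sup>2) - m) = 0"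
      using d(2) unfolding qx dy by (simp add: power2_eq_square algebra_simps)
    then have "m = \<tau> * (x\<^sup>2 + y\<^sup>2)" using assms(1) by simp
    then have "of_real \<tau> * z\<^sup>2 + of_real q * z + of_real m = 0"
      unfolding z x_def [symmetric] y_def [symmetric] qx
      by (simp add: complex_eq_iff power2_eq_square algebra_simps)
    then show "is_eigenvalue \<tau> \<beta> r z \<and> Im z > 0"
      using fac d(1) assms(1) by (simp add: z)
  qed
  show "\<exists>!z. is_eigenvalue \<tau> \<beta> r z \<and> Im z > 0" using iff by simp
  have "lambda2 \<tau> \<beta> r = Complex (- q / (2 * \<tau>)) (d / (2 * \<tau>))"
    unfolding lambda2_def iff by simp
  then show "Re (lambda2 \<tau> \<beta> r) < 0" using q0 assms(1) by simp
qed

end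

theory Submission
  imports Defs "HOL-Probability.Distributions"
begin

text \<open>
  Everything happens at a fixed frequency \<open>\<xi>\<close> with \<open>r = |\<xi>|\<close>; the norms are then recovered by
  integrating a pointwise bound.  The cubic
  \<open>\<tau> \<lambda>\<^sup>3 + \<lambda>\<^sup>2 + \<beta> r\<^sup>2 \<lambda> + r\<^sup>2\<close> always has a real root \<open>-b\<close> with \<open>1/\<beta> < b \<le> 1/\<tau>\<close>.  Splitting off
  the factor \<open>\<lambda> + b\<close> turns the third-order equation into a damped oscillator
  \<open>\<tau> w'' + q w' + m w = 0\<close> for \<open>w = u' + b u\<close>, where \<open>q = 1 - \<tau> b\<close> and \<open>m = r\<^sup>2 / b\<close>, followed by the
  strongly damped first-order equation \<open>u' + b u = w\<close> (\<open>mode_factorisation\<close>).  Working with a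
  real factorisation avoids formulas in terms of the three eigenvalues, which degenerate at
  multiple roots.

  For any rate \<open>\<kappa> \<le> q / (2 \<tau>)\<close> the function \<open>y = e\<^sup>\<kappa>\<^sup>t w\<close> solves an oscillator that still has
  nonnegative damping, with stiffness \<open>M = m - q \<kappa> + \<tau> \<kappa>\<^sup>2\<close>.  If \<open>M \<ge> 0\<close>, its energy
  \<open>\<tau> |y'|\<^sup>2 + M |y|\<^sup>2\<close> is nonincreasing (\<open>oscillator_energy\<close>).  This gives decay of \<open>w\<close> at the
  rate \<open>\<kappa>\<close>, without loss when \<open>M\<close> is bounded below and with a factor \<open>1 + t\<close> in general
  (\<open>damped_oscillator_bounds\<close>).  Since \<open>b > 1/\<beta>\<close> exceeds \<open>\<kappa> \<le> 1/(2 \<beta>)\<close>, the first-order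
  equation passes the bound on to \<open>u\<close> (\<open>first_order_decay\<close>).

  At low frequencies \<open>\<kappa> = q / (2 \<tau>)\<close>, which is comparable to \<open>r\<^sup>2\<close>; the stiffness degenerates as
  \<open>r\<close> tends to \<open>0\<close>, and the resulting factor \<open>1 + t\<close> is the \<open>1\<close> in the exponent
  \<open>1 - N/4 - j/2\<close>; the rest of the exponent comes from a Gaussian moment
  (\<open>low_frequency_bound\<close>, \<open>gaussian_moment_bound\<close>).  At frequencies above the cutoff \<open>\<nu>\<^sub>1\<close> the rate
  is \<open>\<kappa> = c\<close>, which is at most \<open>|Re \<lambda>\<^sub>2\<^sub>,\<^sub>3(\<nu>\<^sub>1)| = q(\<nu>\<^sub>1) / (2 \<tau>)\<close>.  It is admissible because the damping \<open>q\<close>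
  never falls below its value at a small cutoff (\<open>char_root_damping_mono\<close>), and then \<open>M\<close> is at least a
  multiple of \<open>r\<^sup>2\<close> (\<open>high_frequency_bound\<close>).

  On the Fourier side, the transforms of the data are bounded by the \<open>L\<^sup>1\<close> norms at low
  frequencies.  The norms of the derivatives are defined through the \<open>L\<^sup>2\<close> transform, which
  agrees almost everywhere with the Fourier integral of the data and with the mode
  representative of the solution (\<open>L2_fourier_integrable\<close>, \<open>has_L2_fourier_unique\<close>).
\<close>

section \<open>Energy bounds for damped oscillators\<close>

text \<open>
  The energy has derivative \<open>-2 P |y'|\<^sup>2\<close>, as one sees by taking the inner product of the
  equation with \<open>y'\<close>.
\<close>

lemma oscillator_energy:
  fixes y y' y'' :: "real \<Rightarrow> complex"
  assumes "0 \<le> P" and t: "0 \<le> t"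
    and y: "\<And>s. 0 \<le> s \<Longrightarrow> (y has_vector_derivative y' s) (at s within {0..})"
    and y': "\<And>s. 0 \<le> s \<Longrightarrow> (y' has_vector_derivative y'' s) (at s within {0..})"
    and ode: "\<And>s. 0 \<le> s \<Longrightarrow> \<tau> *\<^sub>R y'' s + P *\<^sub>R y' s + M *\<^sub>R y s = 0"
  shows "\<tau> * (cmod (y' t))\<^sup>2 + M * (cmod (y t))\<^sup>2 \<le> \<tau> * (cmod (y' 0))\<^sup>2 + M * (cmod (y 0))\<^sup>2"
proof -
  define E where "E s = \<tau> * (y' s \<bullet> y' s) + M * (y s \<bullet> y s)" for s
  have dE: "(E has_derivative (\<lambda>h. h * (- 2 * P * (y' s \<bullet> y' s)))) (at s within {0..})" if "0 \<le> s" for s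
  proof -
    have "(E has_derivative (\<lambda>h. \<tau> * (y' s \<bullet> (h *\<^sub>R y'' s) + (h *\<^sub>R y'' s) \<bullet> y' s)
        + M * (y s \<bullet> (h *\<^sub>R y' s) + (h *\<^sub>R y' s) \<bullet> y s))) (at s within {0..})"
      unfolding E_def
      by (intro derivative_intros has_derivative_inner
          y[OF that, unfolded has_vector_derivative_def]
          y'[OF that, unfolded has_vector_derivative_def])
    moreover have "(\<lambda>h. \<tau> * (y' s \<bullet> (h *\<^sub>R y'' s) + (h *\<^sub>R y'' s) \<bullet> y' s)
        + M * (y s \<bullet> (h *\<^sub>R y' s) + (h *\<^sub>R y' s) \<bullet> y s)) = (\<lambda>h. h * (- 2 * P * (y' s \<bullet> y' s)))"
    proof
      fix h
      have "y' s \<bullet> (\<tau> *\<^sub>R y'' s + P *\<^sub>R y' s + M *\<^sub>R y s) = 0" using ode[OF that] by simp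
      then have *: "\<tau> * (y' s \<bullet> y'' s) + M * (y' s \<bullet> y s) = - P * (y' s \<bullet> y' s)"
        by (simp add: inner_right_distrib)
      have "\<tau> * (y' s \<bullet> (h *\<^sub>R y'' s) + (h *\<^sub>R y'' s) \<bullet> y' s)
        + M * (y s \<bullet> (h *\<^sub>R y' s) + (h *\<^sub>R y' s) \<bullet> y s)
        = 2 * h * (\<tau> * (y' s \<bullet> y'' s) + M * (y' s \<bullet> y s))"
        by (simp add: inner_commute algebra_simps)
      then show "\<tau> * (y' s \<bullet> (h *\<^sub>R y'' s) + (h *\<^sub>R y'' s) \<bullet> y' s)
        + M * (y s \<bullet> (h *\<^sub>R y' s) + (h *\<^sub>R y' s) \<bullet> y s) = h * (- 2 * P * (y' s \<bullet> y' s))"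
        unfolding * by simp
    qed
    ultimately show ?thesis by simp
  qed
  obtain x where x: "E t - E 0 = (t - 0) * (- 2 * P * (y' x \<bullet> y' x))"
    using mvt_very_simple[OF t, of E "\<lambda>s h. h * (- 2 * P * (y' s \<bullet> y' s))"]
      has_derivative_subset[OF dE, of _ "{0..t}"] by auto
  have "E t - E 0 = - 2 * (t * P * (y' x \<bullet> y' x))" using x by (simp add: algebra_simps)
  moreover have "0 \<le> t * P * (y' x \<bullet> y' x)" using t \<open>0 \<le> P\<close> by simp
  ultimately have "E t \<le> E 0" by linarith
  then show ?thesis by (simp add: E_def dot_square_norm)
qed

text \<open>
  Multiplying by \<open>e\<^sup>\<kappa>\<^sup>t\<close> moves a part \<open>2 \<tau> \<kappa>\<close> of the damping into the stiffness, which becomes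
  \<open>M\<close>, so that the energy of \<open>e\<^sup>\<kappa>\<^sup>t w\<close> is nonincreasing.  The first bound reads off the potential part
  of the energy.  The second one integrates the bound on the kinetic part and stays uniform as
  \<open>M\<close> tends to \<open>0\<close>.
\<close>

lemma damped_oscillator_bounds:
  fixes w w' w'' :: "real \<Rightarrow> complex"
  assumes \<tau>: "0 < \<tau>" and \<kappa>: "0 \<le> \<kappa>" "2 * \<tau> * \<kappa> \<le> q" and t: "0 \<le> t"
    and M: "M = m - q * \<kappa> + \<tau> * \<kappa>\<^sup>2" "0 \<le> M"
    and w: "\<And>s. 0 \<le> s \<Longrightarrow> (w has_vector_derivative w' s) (at s within {0..})"
    and w': "\<And>s. 0 \<le> s \<Longrightarrow> (w' has_vector_derivative w'' s) (at s within {0..})"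
    and ode: "\<And>s. 0 \<le> s \<Longrightarrow> \<tau> *\<^sub>R w'' s + q *\<^sub>R w' s + m *\<^sub>R w s = 0"
  shows "0 < M \<Longrightarrow> exp (\<kappa> * t) * cmod (w t)
           \<le> cmod (w 0) + sqrt (\<tau> / M) * (cmod (w' 0) + \<kappa> * cmod (w 0))"
    and "exp (\<kappa> * t) * cmod (w t)
           \<le> cmod (w 0) + t * (cmod (w' 0) + \<kappa> * cmod (w 0) + sqrt (M / \<tau>) * cmod (w 0))"
proof -
  define y where "y s = exp (\<kappa> * s) *\<^sub>R w s" for s
  define y' where "y' s = exp (\<kappa> * s) *\<^sub>R (w' s + \<kappa> *\<^sub>R w s)" for s
  define y'' where "y'' s = exp (\<kappa> * s) *\<^sub>R (w'' s + (2 * \<kappa>) *\<^sub>R w' s + \<kappa>\<^sup>2 *\<^sub>R w s)" for s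
  have e: "((\<lambda>s. exp (\<kappa> * s)) has_field_derivative \<kappa> * exp (\<kappa> * s)) (at s within {0..})" for s
    by (auto intro!: derivative_eq_intros)
  have dy: "(y has_vector_derivative y' s) (at s within {0..})" if "0 \<le> s" for s
    unfolding y_def y'_def
    by (rule has_vector_derivative_eq_rhs[OF has_vector_derivative_scaleR[OF e w[OF that]]])
       (simp add: algebra_simps)
  have dy': "(y' has_vector_derivative y'' s) (at s within {0..})" if "0 \<le> s" for s
  proof -
    have "((\<lambda>s. w' s + \<kappa> *\<^sub>R w s) has_vector_derivative w'' s + \<kappa> *\<^sub>R w' s) (at s within {0..})"
      using has_vector_derivative_add[OF w'[OF that]
          bounded_linear.has_vector_derivative[OF bounded_linear_scaleR_right w[OF that], of \<kappa>]]
      by simp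
    from has_vector_derivative_scaleR[OF e this] show ?thesis
      unfolding y'_def y''_def
      by (rule has_vector_derivative_eq_rhs)
         (simp add: complex_eq_iff algebra_simps power2_eq_square)
  qed
  have ode_y: "\<tau> *\<^sub>R y'' s + (q - 2 * \<tau> * \<kappa>) *\<^sub>R y' s + M *\<^sub>R y s = 0" if "0 \<le> s" for s
  proof -
    have "\<tau> *\<^sub>R y'' s + (q - 2 * \<tau> * \<kappa>) *\<^sub>R y' s + M *\<^sub>R y s
       = exp (\<kappa> * s) *\<^sub>R (\<tau> *\<^sub>R w'' s + q *\<^sub>R w' s + m *\<^sub>R w s)"
      unfolding y_def y'_def y''_def M(1)
      by (simp add: complex_eq_iff algebra_simps power2_eq_square)
    then show ?thesis using ode[OF that] by simp
  qed
  define D where "D = cmod (w' 0) + \<kappa> * cmod (w 0)"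
  have D0: "0 \<le> D" using \<kappa> by (simp add: D_def)
  have y0: "y 0 = w 0" "cmod (y' 0) \<le> D"
    using norm_triangle_ineq[of "w' 0" "\<kappa> *\<^sub>R w 0"] \<kappa> by (auto simp: y_def y'_def D_def)
  have energy: "\<tau> * (cmod (y' s))\<^sup>2 + M * (cmod (y s))\<^sup>2 \<le> \<tau> * D\<^sup>2 + M * (cmod (w 0))\<^sup>2"
    if "0 \<le> s" for s
  proof -
    have "\<tau> * (cmod (y' s))\<^sup>2 + M * (cmod (y s))\<^sup>2 \<le> \<tau> * (cmod (y' 0))\<^sup>2 + M * (cmod (y 0))\<^sup>2"
      using \<kappa> by (intro oscillator_energy[where P = "q - 2 * \<tau> * \<kappa>", OF _ that dy dy' ode_y]) auto
    moreover have "\<tau> * (cmod (y' 0))\<^sup>2 \<le> \<tau> * D\<^sup>2"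
      using y0 \<tau> by (intro mult_left_mono power_mono) auto
    ultimately show ?thesis using y0 by simp
  qed
  have ny: "exp (\<kappa> * t) * cmod (w t) = cmod (y t)" by (simp add: y_def)
  show "exp (\<kappa> * t) * cmod (w t) \<le> cmod (w 0) + sqrt (\<tau> / M) * (cmod (w' 0) + \<kappa> * cmod (w 0))"
    if "0 < M"
  proof -
    have "M * (cmod (y t))\<^sup>2 \<le> \<tau> * D\<^sup>2 + M * (cmod (w 0))\<^sup>2"
      using energy[OF t] \<tau> by (smt (verit) mult_nonneg_nonneg zero_le_power2)
    then have "(cmod (y t))\<^sup>2 \<le> (cmod (w 0))\<^sup>2 + (sqrt (\<tau> / M) * D)\<^sup>2"
      using that \<tau> by (simp add: power_mult_distrib field_simps)
    also have "\<dots> \<le> (cmod (w 0) + sqrt (\<tau> / M) * D)\<^sup>2"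
      using D0 \<tau> that by (simp add: power2_sum)
    finally show ?thesis unfolding ny D_def[symmetric]
      by (rule power2_le_imp_le) (use D0 \<tau> that in auto)
  qed
  define B where "B = D + sqrt (M / \<tau>) * cmod (w 0)"
  have B: "cmod (y' s) \<le> B" if "0 \<le> s" for s
  proof -
    have "\<tau> * (cmod (y' s))\<^sup>2 \<le> \<tau> * D\<^sup>2 + M * (cmod (w 0))\<^sup>2"
      using energy[OF that] M(2) by (smt (verit) mult_nonneg_nonneg zero_le_power2)
    then have "(cmod (y' s))\<^sup>2 \<le> D\<^sup>2 + (sqrt (M / \<tau>) * cmod (w 0))\<^sup>2"
      using \<tau> M(2) by (simp add: power_mult_distrib field_simps)
    also have "\<dots> \<le> B\<^sup>2"
      using D0 \<tau> M(2) by (simp add: power2_sum B_def)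
    finally show ?thesis
      by (rule power2_le_imp_le) (use D0 \<tau> M(2) in \<open>auto simp: B_def\<close>)
  qed
  have "cmod (y t - y 0) \<le> B * t"
  proof (cases "t = 0")
    case False
    have cont: "continuous_on {0..t} y"
      by (rule continuous_on_subset[OF continuous_on_vector_derivative[of "{0..}" y y']])
         (use dy in auto)
    have "norm (y t - y 0) \<le> B * t - B * 0"
    proof (rule differentiable_bound_general[OF _ cont, where f' = y' and \<phi>' = "\<lambda>_. B"])
      show "(y has_vector_derivative y' x) (at x)" if "0 < x" "x < t" for x
        using dy[of x] at_within_interior[of x "{0..}"] that by (simp add: interior_real_atLeast)
    qed (use t False B in \<open>auto intro!: continuous_intros derivative_eq_intros\<close>)
    then show ?thesis by simp
  qed simp
  then show "exp (\<kappa> * t) * cmod (w t)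
      \<le> cmod (w 0) + t * (cmod (w' 0) + \<kappa> * cmod (w 0) + sqrt (M / \<tau>) * cmod (w 0))"
    unfolding ny using norm_triangle_ineq2[of "y t" "y 0"] y0(1)
    by (simp add: B_def D_def mult.commute)
qed

text \<open>
  The solution is \<open>e\<^sup>-\<^sup>b\<^sup>t u(0)\<close> plus the convolution of \<open>e\<^sup>-\<^sup>b\<^sup>t\<close> with \<open>w\<close>, and a forcing that decays at the
  slower rate \<open>\<kappa>\<close> dominates with a factor \<open>1 / (b - \<kappa>)\<close>.  The hypothesis on \<open>w\<close> is confined to
  the interval up to \<open>t\<close> so that \<open>G\<close> may depend on \<open>t\<close>.
\<close>

lemma first_order_decay:
  fixes u w :: "real \<Rightarrow> complex"
  assumes u: "\<And>s. 0 \<le> s \<Longrightarrow> (u has_vector_derivative w s - b *\<^sub>R u s) (at s within {0..})"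
    and w: "\<And>s. 0 \<le> s \<Longrightarrow> s \<le> t \<Longrightarrow> exp (\<kappa> * s) * cmod (w s) \<le> G"
    and "\<kappa> < b" "0 \<le> t"
  shows "exp (\<kappa> * t) * cmod (u t) \<le> cmod (u 0) + G / (b - \<kappa>)"
proof -
  define y where "y s = exp (b * s) *\<^sub>R u s" for s
  have G: "0 \<le> G" using w[of 0] assms by (smt (verit) exp_ge_zero mult_nonneg_nonneg norm_ge_zero)
  have dy: "(y has_vector_derivative exp (b * s) *\<^sub>R w s) (at s within {0..})" if "0 \<le> s" for s
  proof -
    have e: "((\<lambda>s. exp (b * s)) has_field_derivative b * exp (b * s)) (at s within {0..})"
      by (auto intro!: derivative_eq_intros)
    show ?thesis unfolding y_def
      by (rule has_vector_derivative_eq_rhs[OF has_vector_derivative_scaleR[OF e u[OF that]]])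
         (simp add: algebra_simps)
  qed
  have "cmod (y t - y 0) \<le> G / (b - \<kappa>) * exp ((b - \<kappa>) * t)"
  proof (cases "t = 0")
    case False
    have cont: "continuous_on {0..t} y"
      by (rule continuous_on_subset[OF continuous_on_vector_derivative[of "{0..}" y]])
         (use dy in auto)
    have "norm (y t - y 0) \<le> G / (b - \<kappa>) * exp ((b - \<kappa>) * t) - G / (b - \<kappa>) * exp ((b - \<kappa>) * 0)"
    proof (rule differentiable_bound_general[OF _ cont,
          where f' = "\<lambda>s. exp (b * s) *\<^sub>R w s" and \<phi>' = "\<lambda>s. G * exp ((b - \<kappa>) * s)"])
      show "(y has_vector_derivative exp (b * x) *\<^sub>R w x) (at x)" if "0 < x" "x < t" for x
        using dy[of x] at_within_interior[of x "{0..}"] that by (simp add: interior_real_atLeast)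
      show "norm (exp (b * x) *\<^sub>R w x) \<le> G * exp ((b - \<kappa>) * x)" if "0 < x" "x < t" for x
      proof -
        have "norm (exp (b * x) *\<^sub>R w x) = exp ((b - \<kappa>) * x) * (exp (\<kappa> * x) * cmod (w x))"
          by (simp add: algebra_simps flip: exp_add mult.assoc)
        also have "\<dots> \<le> exp ((b - \<kappa>) * x) * G"
          using w[of x] that by (intro mult_left_mono) auto
        finally show ?thesis by (simp add: mult.commute)
      qed
      show "((\<lambda>s. G / (b - \<kappa>) * exp ((b - \<kappa>) * s)) has_vector_derivative G * exp ((b - \<kappa>) * x)) (at x)"
        for x
        unfolding has_real_derivative_iff_has_vector_derivative[symmetric]
        using \<open>\<kappa> < b\<close> by (auto intro!: derivative_eq_intros)
    qed (use assms False in \<open>auto intro!: continuous_intros\<close>)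
    moreover have "0 \<le> G / (b - \<kappa>)" using G \<open>\<kappa> < b\<close> by simp
    ultimately show ?thesis by simp
  qed (use G \<open>\<kappa> < b\<close> in simp)
  then have "exp (b * t) * cmod (u t) \<le> cmod (u 0) + G / (b - \<kappa>) * exp ((b - \<kappa>) * t)"
    using norm_triangle_ineq2[of "y t" "y 0"] by (simp add: y_def)
  also have "\<dots> \<le> (cmod (u 0) + G / (b - \<kappa>)) * exp ((b - \<kappa>) * t)"
    using assms by (simp add: distrib_right mult_le_cancel_left1)
  also have "exp (b * t) = exp ((b - \<kappa>) * t) * exp (\<kappa> * t)"
    by (simp add: algebra_simps flip: exp_add)
  finally have "exp ((b - \<kappa>) * t) * (exp (\<kappa> * t) * cmod (u t)) \<le> exp ((b - \<kappa>) * t) * (cmod (u 0) + G / (b - \<kappa>))"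
    by (simp only: mult_ac)
  then show ?thesis by simp
qed

section \<open>The real root of the characteristic cubic\<close>

text \<open>
  The equation says that \<open>-b\<close> is a root of \<open>\<tau> \<lambda>\<^sup>3 + \<lambda>\<^sup>2 + \<beta> r\<^sup>2 \<lambda> + r\<^sup>2\<close>.  For \<open>r > 0\<close> every real
  root lies in the stated interval.  At \<open>r = 0\<close> the interval excludes the double root \<open>0\<close> and
  selects \<open>b = 1/\<tau>\<close>.
\<close>

definition char_root :: "real \<Rightarrow> real \<Rightarrow> real \<Rightarrow> real \<Rightarrow> bool" where
  "char_root \<tau> \<beta> r b \<longleftrightarrow> 1 / \<beta> < b \<and> b \<le> 1 / \<tau> \<and> b\<^sup>2 * (1 - \<tau> * b) = r\<^sup>2 * (\<beta> * b - 1)"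

lemma char_root_exists:
  assumes "0 < \<tau>" "\<tau> < \<beta>"
  shows "\<exists>b. char_root \<tau> \<beta> r b"
proof -
  let ?p = "\<lambda>b. b\<^sup>2 * (1 - \<tau> * b) - r\<^sup>2 * (\<beta> * b - 1)"
  have lo: "0 < ?p (1 / \<beta>)"
    using assms by (simp add: field_simps)
  have hi: "?p (1 / \<tau>) \<le> 0"
    using assms by (simp add: mult_nonneg_nonneg)
  have le: "1 / \<beta> \<le> 1 / \<tau>" using assms by (simp add: field_simps)
  have "continuous_on {1 / \<beta>..1 / \<tau>} ?p"
    by (intro continuous_intros)
  from IVT2'[OF hi less_imp_le[OF lo] le this]
  obtain b where b: "1 / \<beta> \<le> b" "b \<le> 1 / \<tau>" "?p b = 0" by blast
  with lo have "1 / \<beta> \<noteq> b" by force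
  with b show ?thesis by (auto simp: char_root_def intro!: exI[of _ b])
qed

lemma char_root_pos:
  assumes "0 < \<tau>" "\<tau> < \<beta>" "char_root \<tau> \<beta> r b"
  shows "0 < b" "1 < \<beta> * b" "\<tau> * b \<le> 1"
proof -
  have "0 < 1 / \<beta>" using assms by simp
  then show "0 < b" using assms(3) unfolding char_root_def by linarith
  show "1 < \<beta> * b" "\<tau> * b \<le> 1"
    using assms by (auto simp: char_root_def field_simps)
qed

text \<open>
  The damping is \<open>r\<^sup>2 (\<beta> b - 1) / b\<^sup>2\<close>, and \<open>\<beta> b - 1 \<le> (\<beta> b / 2)\<^sup>2\<close> by completing the square.
\<close>

lemma char_root_damping_le:
  assumes "0 < \<tau>" "\<tau> < \<beta>" "char_root \<tau> \<beta> r b"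
  shows "1 - \<tau> * b \<le> (\<beta> * r / 2)\<^sup>2"
proof -
  note b = char_root_pos[OF assms]
  have "b\<^sup>2 * (1 - \<tau> * b) = r\<^sup>2 * (\<beta> * b - 1)" using assms by (simp add: char_root_def)
  also have "\<dots> \<le> r\<^sup>2 * (\<beta> * b / 2)\<^sup>2"
    by (rule mult_left_mono) (use sum_squares_ge_zero[of "\<beta> * b / 2 - 1" 0] in
      \<open>auto simp: power2_eq_square algebra_simps\<close>)
  also have "\<dots> = b\<^sup>2 * (\<beta> * r / 2)\<^sup>2" by (simp add: power2_eq_square)
  finally show ?thesis using b by simp
qed

text \<open>
  When the damping \<open>1 - \<tau> b\<close> is small, \<open>b\<close> is close to \<open>1/\<tau>\<close>, hence well separated from \<open>1/\<beta>\<close>,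
  and the factor \<open>(\<beta> b - 1) / b\<^sup>2\<close> of \<open>r\<^sup>2\<close> in the damping is bounded below.
\<close>

lemma char_root_damping_ge:
  assumes "0 < \<tau>" "\<tau> < \<beta>" "char_root \<tau> \<beta> r b" "1 - \<tau> * b \<le> (\<beta> - \<tau>) / (2 * \<beta>)"
  shows "\<tau> * (\<beta> - \<tau>) / 2 * r\<^sup>2 \<le> 1 - \<tau> * b"
proof -
  note b = char_root_pos[OF assms(1-3)]
  have "b\<^sup>2 * (\<tau> * (\<beta> - \<tau>) / 2 * r\<^sup>2) = (\<tau> * b)\<^sup>2 * ((\<beta> - \<tau>) / (2 * \<tau>) * r\<^sup>2)"
    using assms(1) by (simp add: power2_eq_square field_simps)
  also have "\<dots> \<le> 1 * ((\<beta> - \<tau>) / (2 * \<tau>) * r\<^sup>2)"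
    using b assms(1,2) by (intro mult_right_mono power_le_one) auto
  also have "\<dots> \<le> (\<beta> * b - 1) * r\<^sup>2"
  proof -
    have "(1 - \<tau> * b) * (2 * \<beta>) \<le> \<beta> - \<tau>"
      using assms(1,2,4) by (simp add: pos_le_divide_eq)
    then have "(\<beta> - \<tau>) / (2 * \<tau>) \<le> \<beta> * b - 1"
      using assms(1,2) by (simp add: field_simps)
    then show ?thesis using mult_right_mono[of "(\<beta> - \<tau>) / (2 * \<tau>)" "\<beta> * b - 1" "r\<^sup>2"] by simp
  qed
  also have "\<dots> = b\<^sup>2 * (1 - \<tau> * b)" using assms(3) by (simp add: char_root_def)
  finally show ?thesis using b by simp
qed

text \<open>
  The function \<open>b \<mapsto> b\<^sup>2 (1 - \<tau> b) / (\<beta> b - 1)\<close>, which expresses \<open>r\<^sup>2\<close> in terms of \<open>b\<close>, decreases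
  for \<open>\<tau> b \<ge> 2/3\<close>: there its numerator decreases and its denominator increases.  So a root beyond
  \<open>a\<close> belongs to a frequency below \<open>r\<close>.  Only \<open>a\<close> has to lie in this range; at
  intermediate frequencies \<open>s\<close> there may be three real roots, and \<open>b\<close> is any of them.
\<close>

lemma char_root_damping_mono:
  assumes \<tau>: "0 < \<tau>" "\<tau> < \<beta>" and a: "char_root \<tau> \<beta> r a" "1 - \<tau> * a \<le> 1 / 3"
    and b: "char_root \<tau> \<beta> s b" and rs: "0 \<le> r" "r \<le> s"
  shows "1 - \<tau> * a \<le> 1 - \<tau> * b"
proof (rule ccontr)
  assume "\<not> ?thesis"
  then have ab: "a < b" using \<tau> by simp
  note a' = char_root_pos[OF \<tau> a(1)] and b' = char_root_pos[OF \<tau> b]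
  have "b\<^sup>2 * (1 - \<tau> * b) < a\<^sup>2 * (1 - \<tau> * a)"
  proof -
    have ta: "2 / 3 \<le> \<tau> * a" using a(2) by simp
    have tb: "2 / 3 < \<tau> * b"
      using ta mult_strict_left_mono[OF ab, of \<tau>] \<tau>(1) by linarith
    have A: "2 / 3 * a \<le> \<tau> * a * a" "2 / 3 * b < \<tau> * b * b" "2 / 3 * b \<le> \<tau> * a * b"
      using mult_right_mono[OF ta, of a] mult_strict_right_mono[OF tb, of b]
        mult_right_mono[OF ta, of b] a' b' by simp_all
    have "2 / 3 * a < \<tau> * a * b"
      using A(1) mult_strict_left_mono[OF ab, of "\<tau> * a"] mult_pos_pos[OF \<tau>(1) a'(1)] by linarith
    then have "a + b < \<tau> * (a\<^sup>2 + a * b + b\<^sup>2)"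
      using A by (simp add: power2_eq_square algebra_simps)
    then have "(b - a) * (a + b) < (b - a) * (\<tau> * (a\<^sup>2 + a * b + b\<^sup>2))"
      using ab by (intro mult_strict_left_mono) auto
    then show ?thesis by (simp add: power2_eq_square algebra_simps)
  qed
  then have "s\<^sup>2 * (\<beta> * b - 1) < r\<^sup>2 * (\<beta> * a - 1)"
    using a(1) b by (simp add: char_root_def)
  also have "\<dots> \<le> s\<^sup>2 * (\<beta> * b - 1)"
    using a' ab rs \<tau> by (intro mult_mono power_mono) auto
  finally show False by simp
qed

text \<open>
  The nonreal pair consists of the roots of the remaining quadratic factor
  \<open>\<tau> \<lambda>\<^sup>2 + (1 - \<tau> b) \<lambda> + r\<^sup>2 / b\<close>, whose sum is \<open>-(1 - \<tau> b) / \<tau>\<close>.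
\<close>

lemma Re_lambda2_eq:
  assumes \<tau>: "0 < \<tau>" "\<tau> < \<beta>" and r: "0 < r" "r < 2 * \<tau>\<^sup>2 / \<beta> ^ 3"
    and b: "char_root \<tau> \<beta> r b"
  shows "\<bar>Re (lambda2 \<tau> \<beta> r)\<bar> = (1 - \<tau> * b) / (2 * \<tau>)"
proof -
  note b' = char_root_pos[OF \<tau> b]
  define z where "z = lambda2 \<tau> \<beta> r"
  have z: "is_eigenvalue \<tau> \<beta> r z" "Im z > 0"
    using theI'[OF lambda2_well_defined(1)[OF \<tau> r]] by (auto simp: z_def lambda2_def)
  define x y where "x = Re z" and "y = Im z"
  have y: "0 < y" using z by (simp add: y_def)
  have im: "\<tau> * (3 * x\<^sup>2 * y - y ^ 3) + 2 * x * y + \<beta> * r\<^sup>2 * y = 0"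
    using arg_cong[OF z(1)[unfolded is_eigenvalue_def], of Im]
    by (simp add: x_def y_def power2_eq_square power3_eq_cube algebra_simps)
  have re: "\<tau> * (x ^ 3 - 3 * x * y\<^sup>2) + (x\<^sup>2 - y\<^sup>2) + \<beta> * r\<^sup>2 * x + r\<^sup>2 = 0"
    using arg_cong[OF z(1)[unfolded is_eigenvalue_def], of Re]
    by (simp add: x_def y_def power2_eq_square power3_eq_cube algebra_simps)
  define m where "m = \<beta> * r\<^sup>2 - b * (1 - \<tau> * b)"
  have bm: "b * m = r\<^sup>2"
    using b by (simp add: char_root_def m_def power2_eq_square algebra_simps)
  have br: "\<beta> * r\<^sup>2 = m + b * (1 - \<tau> * b)" by (simp add: m_def)
  \<comment> \<open>\<open>A\<close> and \<open>B\<close> are the real and imaginary parts of the quadratic factor at \<open>z = x + i y\<close>; its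
    product with \<open>z + b\<close> vanishes, and \<open>z + b\<close> does not.\<close>
  define A where "A = \<tau> * (x\<^sup>2 - y\<^sup>2) + (1 - \<tau> * b) * x + m"
  define B where "B = y * (2 * \<tau> * x + (1 - \<tau> * b))"
  have 1: "(x + b) * A - y * B = 0"
    using re br bm unfolding A_def B_def by algebra
  have 2: "(x + b) * B + y * A = 0"
    using im br unfolding A_def B_def by algebra
  have "((x + b)\<^sup>2 + y\<^sup>2) * B = 0" using 1 2 by algebra
  moreover have "(x + b)\<^sup>2 + y\<^sup>2 > 0" using y by (simp add: add_nonneg_pos)
  ultimately have "2 * \<tau> * x + (1 - \<tau> * b) = 0" using y by (simp add: B_def)
  then have "x = - ((1 - \<tau> * b) / (2 * \<tau>))" using \<tau> by (simp add: field_simps)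
  moreover have "0 \<le> (1 - \<tau> * b) / (2 * \<tau>)" using b' \<tau> by simp
  ultimately show ?thesis unfolding x_def z_def by linarith
qed

section \<open>Decay of a single Fourier mode\<close>

text \<open>
  By \<open>char_root_damping_le\<close>, \<open>(\<beta> \<nu> / 2)\<^sup>2\<close> bounds the damping \<open>q = 1 - \<tau> b\<close> at all frequencies up
  to \<open>\<nu>\<close>.  Below \<open>2 \<tau>\<^sup>2 / \<beta>\<^sup>3\<close> the nonreal pair of eigenvalues is known to exist.  The bound \<open>1/3\<close>
  puts \<open>b\<close> into the range of \<open>char_root_damping_mono\<close>, the bound \<open>(\<beta> - \<tau>) / (2 \<beta>)\<close> into that of
  \<open>char_root_damping_ge\<close>; the bound \<open>\<tau> / \<beta>\<close> keeps the rate \<open>q / (2 \<tau>)\<close> below \<open>1 / (2 \<beta>)\<close>, hence away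
  from \<open>b\<close>; the bound \<open>4 \<tau>\<^sup>2 / \<beta>\<^sup>2\<close> keeps the shifted stiffness \<open>M\<close> nonnegative.
\<close>

definition admissible_cutoff :: "real \<Rightarrow> real \<Rightarrow> real \<Rightarrow> bool" where
  "admissible_cutoff \<tau> \<beta> \<nu> \<longleftrightarrow> 0 < \<nu> \<and> \<nu> < 2 * \<tau>\<^sup>2 / \<beta> ^ 3 \<and> (\<beta> * \<nu> / 2)\<^sup>2 \<le> 1 / 3 \<and>
     (\<beta> * \<nu> / 2)\<^sup>2 \<le> (\<beta> - \<tau>) / (2 * \<beta>) \<and> (\<beta> * \<nu> / 2)\<^sup>2 \<le> \<tau> / \<beta> \<and>
     (\<beta> * \<nu> / 2)\<^sup>2 \<le> 4 * \<tau>\<^sup>2 / \<beta>\<^sup>2"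

lemma admissible_cutoff_small:
  assumes "0 < \<tau>" "\<tau> < \<beta>"
  shows "\<exists>\<nu>0>0. \<forall>\<nu>. 0 < \<nu> \<longrightarrow> \<nu> < \<nu>0 \<longrightarrow> admissible_cutoff \<tau> \<beta> \<nu>"
proof -
  have "((\<lambda>\<nu>. (\<beta> * \<nu> / 2)\<^sup>2) \<longlongrightarrow> (\<beta> * 0 / 2)\<^sup>2) (at_right 0)"
    by (intro tendsto_intros) auto
  note lim = order_tendstoD(2)[OF this]
  have sq: "\<forall>\<^sub>F \<nu> in at_right 0. (\<beta> * \<nu> / 2)\<^sup>2 \<le> \<delta>" if "0 < \<delta>" for \<delta>
    by (rule eventually_mono[OF lim[of \<delta>]]) (use that in auto)
  have "\<forall>\<^sub>F \<nu> in at_right 0. admissible_cutoff \<tau> \<beta> \<nu>"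
    unfolding admissible_cutoff_def using assms
    by (intro eventually_conj sq eventually_at_right_less
        eventually_mono[OF eventually_at_right_real[of 0 "2 * \<tau>\<^sup>2 / \<beta> ^ 3"]]) auto
  then show ?thesis by (auto simp: eventually_at_right_field)
qed

text \<open>
  This is the condition that \<open>is_solution\<close> imposes at a frequency of norm \<open>r\<close>, written with real scalar
  multiplication, for which the rules on vector derivatives are stated.
\<close>

definition solves_mode :: "real \<Rightarrow> real \<Rightarrow> real \<Rightarrow> (real \<Rightarrow> complex) \<Rightarrow> complex \<Rightarrow> complex \<Rightarrow> complex \<Rightarrow> bool"
  where "solves_mode \<tau> \<beta> r u v0 v1 v2 \<longleftrightarrow> (\<exists>V W Z.
     (\<forall>t\<ge>0. (u has_vector_derivative V t) (at t within {0..}) \<and>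
            (V has_vector_derivative W t) (at t within {0..}) \<and>
            (W has_vector_derivative Z t) (at t within {0..}) \<and>
            \<tau> *\<^sub>R Z t + W t + r\<^sup>2 *\<^sub>R u t + (\<beta> * r\<^sup>2) *\<^sub>R V t = 0) \<and>
     u 0 = v0 \<and> V 0 = v1 \<and> W 0 = v2)"

text \<open>
  The differential operator factors like the cubic, as \<open>\<tau> \<partial>\<^sup>2 + (1 - \<tau> b) \<partial> + r\<^sup>2 / b\<close> composed
  with \<open>\<partial> + b\<close>.
\<close>

lemma mode_factorisation:
  assumes \<tau>: "0 < \<tau>" "\<tau> < \<beta>" and b: "char_root \<tau> \<beta> r b"
    and u: "solves_mode \<tau> \<beta> r u v0 v1 v2"
  obtains w w' w'' where
    "\<And>t. 0 \<le> t \<Longrightarrow> (u has_vector_derivative w t - b *\<^sub>R u t) (at t within {0..})"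
    "\<And>t. 0 \<le> t \<Longrightarrow> (w has_vector_derivative w' t) (at t within {0..})"
    "\<And>t. 0 \<le> t \<Longrightarrow> (w' has_vector_derivative w'' t) (at t within {0..})"
    "\<And>t. 0 \<le> t \<Longrightarrow> \<tau> *\<^sub>R w'' t + (1 - \<tau> * b) *\<^sub>R w' t + (r\<^sup>2 / b) *\<^sub>R w t = 0"
    "u 0 = v0" "w 0 = v1 + b *\<^sub>R v0" "w' 0 = v2 + b *\<^sub>R v1"
proof -
  from u obtain V W Z where
    V: "\<And>t. 0 \<le> t \<Longrightarrow> (u has_vector_derivative V t) (at t within {0..})" and
    W: "\<And>t. 0 \<le> t \<Longrightarrow> (V has_vector_derivative W t) (at t within {0..})" and
    Z: "\<And>t. 0 \<le> t \<Longrightarrow> (W has_vector_derivative Z t) (at t within {0..})" and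
    ode: "\<And>t. 0 \<le> t \<Longrightarrow> \<tau> *\<^sub>R Z t + W t + r\<^sup>2 *\<^sub>R u t + (\<beta> * r\<^sup>2) *\<^sub>R V t = 0" and
    ini: "u 0 = v0" "V 0 = v1" "W 0 = v2"
    unfolding solves_mode_def by blast
  note b' = char_root_pos[OF \<tau> b]
  define m where "m = r\<^sup>2 / b"
  have bm: "b * m = r\<^sup>2" using b' by (simp add: m_def)
  \<comment> \<open>The linear coefficients of the cubic and of the product of its factors agree.\<close>
  have "b * (m + b * (1 - \<tau> * b)) = b * (\<beta> * r\<^sup>2)"
    using b by (simp add: distrib_left bm char_root_def power2_eq_square algebra_simps)
  then have br: "\<beta> * r\<^sup>2 = m + b * (1 - \<tau> * b)" using b' by simp
  have scale: "((\<lambda>s. b *\<^sub>R f s) has_vector_derivative b *\<^sub>R f') (at t within {0..})"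
    if "(f has_vector_derivative f') (at t within {0..})" for f :: "real \<Rightarrow> complex" and f' t
    using bounded_linear.has_vector_derivative[OF bounded_linear_scaleR_right that] .
  show thesis
  proof (rule that[of "\<lambda>t. V t + b *\<^sub>R u t" "\<lambda>t. W t + b *\<^sub>R V t" "\<lambda>t. Z t + b *\<^sub>R W t"])
    fix t :: real assume t: "0 \<le> t"
    show "((\<lambda>t. V t + b *\<^sub>R u t) has_vector_derivative W t + b *\<^sub>R V t) (at t within {0..})"
      by (intro has_vector_derivative_add W V scale t)
    show "((\<lambda>t. W t + b *\<^sub>R V t) has_vector_derivative Z t + b *\<^sub>R W t) (at t within {0..})"
      by (intro has_vector_derivative_add W Z scale t)
    show "\<tau> *\<^sub>R (Z t + b *\<^sub>R W t) + (1 - \<tau> * b) *\<^sub>R (W t + b *\<^sub>R V t) + (r\<^sup>2 / b) *\<^sub>R (V t + b *\<^sub>R u t) = 0"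
      using ode[OF t] unfolding br m_def[symmetric] unfolding bm[symmetric]
      by (simp add: complex_eq_iff algebra_simps)
  qed (use V ini in auto)
qed

text \<open>
  This reduces the decay of a mode to that of its oscillator factor.  The rate \<open>\<kappa>\<close> is at most
  \<open>1 / (2 \<beta>)\<close> and \<open>b\<close> is at least \<open>1 / \<beta>\<close>, so the loss \<open>1 / (b - \<kappa>)\<close> in the first-order
  equation is at most \<open>2 \<beta>\<close>.  The factor \<open>1 + 1/\<tau>\<close> bounds the initial data of
  \<open>w = u' + b u\<close> by those of \<open>u\<close>.
\<close>

lemma mode_bound:
  assumes \<tau>: "0 < \<tau>" "\<tau> < \<beta>" and b: "char_root \<tau> \<beta> r b"
    and u: "solves_mode \<tau> \<beta> r u v0 v1 v2"
    and \<kappa>: "\<kappa> \<le> 1 / (2 * \<beta>)" and L: "0 \<le> L" and t: "0 \<le> t"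
    and oscillator: "\<And>w w' w'' A s. 0 \<le> s \<Longrightarrow> s \<le> t \<Longrightarrow>
      (\<And>t. 0 \<le> t \<Longrightarrow> (w has_vector_derivative w' t) (at t within {0..})) \<Longrightarrow>
      (\<And>t. 0 \<le> t \<Longrightarrow> (w' has_vector_derivative w'' t) (at t within {0..})) \<Longrightarrow>
      (\<And>t. 0 \<le> t \<Longrightarrow> \<tau> *\<^sub>R w'' t + (1 - \<tau> * b) *\<^sub>R w' t + (r\<^sup>2 / b) *\<^sub>R w t = 0) \<Longrightarrow>
      cmod (w 0) \<le> A \<Longrightarrow> cmod (w' 0) \<le> A \<Longrightarrow> exp (\<kappa> * s) * cmod (w s) \<le> L * A"
  shows "cmod (u t) \<le> (1 + 2 * \<beta> * (1 + 1 / \<tau>) * L) * exp (- (\<kappa> * t)) * (cmod v0 + cmod v1 + cmod v2)"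
proof -
  define S where "S = cmod v0 + cmod v1 + cmod v2"
  define A where "A = (1 + 1 / \<tau>) * S"
  have S: "0 \<le> S" by (simp add: S_def)
  have A: "0 \<le> A" using S \<tau> by (simp add: A_def)
  have \<beta>: "0 < \<beta>" using \<tau> by simp
  note b' = char_root_pos[OF \<tau> b]
  have b\<tau>: "b \<le> 1 / \<tau>" "1 / \<beta> < b" using b by (auto simp: char_root_def)
  have gap: "1 / (2 * \<beta>) \<le> b - \<kappa>" using \<kappa> b\<tau> by (simp add: field_simps)
  then have "0 < b - \<kappa>" using \<beta> by (smt (verit) zero_less_divide_1_iff zero_less_mult_iff)
  obtain w w' w'' where
    w: "\<And>t. 0 \<le> t \<Longrightarrow> (u has_vector_derivative w t - b *\<^sub>R u t) (at t within {0..})"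
       "\<And>t. 0 \<le> t \<Longrightarrow> (w has_vector_derivative w' t) (at t within {0..})"
       "\<And>t. 0 \<le> t \<Longrightarrow> (w' has_vector_derivative w'' t) (at t within {0..})"
       "\<And>t. 0 \<le> t \<Longrightarrow> \<tau> *\<^sub>R w'' t + (1 - \<tau> * b) *\<^sub>R w' t + (r\<^sup>2 / b) *\<^sub>R w t = 0"
    and ini: "u 0 = v0" "w 0 = v1 + b *\<^sub>R v0" "w' 0 = v2 + b *\<^sub>R v1"
    using mode_factorisation[OF \<tau> b u] by blast
  have v: "cmod v1 + b * cmod v0 \<le> A" "cmod v2 + b * cmod v1 \<le> A"
  proof -
    have "b * cmod x \<le> 1 / \<tau> * S" if "cmod x \<le> S" for x :: complex
      using b\<tau> b'(1) \<tau> that by (intro mult_mono) auto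
    from this[of v0] this[of v1]
    show "cmod v1 + b * cmod v0 \<le> A" "cmod v2 + b * cmod v1 \<le> A"
      using norm_ge_zero[of v0] norm_ge_zero[of v1] norm_ge_zero[of v2]
      unfolding A_def distrib_right by (auto simp: S_def simp del: norm_ge_zero)
  qed
  have w0: "cmod (w 0) \<le> A" "cmod (w' 0) \<le> A"
    using norm_triangle_ineq[of v1 "b *\<^sub>R v0"] norm_triangle_ineq[of v2 "b *\<^sub>R v1"] v b'(1)
    by (auto simp: ini)
  have "exp (\<kappa> * t) * cmod (u t) \<le> cmod v0 + L * A / (b - \<kappa>)"
    using first_order_decay[OF w(1) oscillator[OF _ _ w(2,3,4) w0] _ t] \<open>0 < b - \<kappa>\<close>
    by (simp add: ini)
  also have "\<dots> \<le> S + L * A * (2 * \<beta>)"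
  proof (rule add_mono)
    show "cmod v0 \<le> S" by (simp add: S_def)
    have "1 / (b - \<kappa>) \<le> 1 / (1 / (2 * \<beta>))"
      using gap \<beta> \<open>0 < b - \<kappa>\<close> by (intro divide_left_mono) auto
    then have "L * A * (1 / (b - \<kappa>)) \<le> L * A * (2 * \<beta>)"
      using L A by (intro mult_left_mono) auto
    then show "L * A / (b - \<kappa>) \<le> L * A * (2 * \<beta>)" by simp
  qed
  finally have *: "exp (\<kappa> * t) * cmod (u t) \<le> (1 + 2 * \<beta> * (1 + 1 / \<tau>) * L) * S"
    by (simp add: A_def algebra_simps)
  have "cmod (u t) = exp (- (\<kappa> * t)) * (exp (\<kappa> * t) * cmod (u t))"
    by (simp flip: exp_add mult.assoc)
  also have "\<dots> \<le> exp (- (\<kappa> * t)) * ((1 + 2 * \<beta> * (1 + 1 / \<tau>) * L) * S)"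
    using * by (intro mult_left_mono) auto
  finally show ?thesis by (simp add: S_def mult_ac)
qed

text \<open>
  The rate \<open>q / (2 \<tau>)\<close> removes all of the damping and leaves the stiffness \<open>M = m - q\<^sup>2 / (4 \<tau>)\<close>.
  This is of order \<open>r\<^sup>2\<close>, so only the bound with linear growth is uniform in \<open>r\<close>.  The rate
  itself is at least \<open>(\<beta> - \<tau>) r\<^sup>2 / 4\<close>, which makes the exponential a Gaussian in \<open>r\<close>.
\<close>

lemma low_frequency_bound:
  assumes \<tau>: "0 < \<tau>" "\<tau> < \<beta>" and \<nu>: "admissible_cutoff \<tau> \<beta> \<nu>"
  shows "\<exists>C>0. \<forall>r u v0 v1 v2 t. 0 \<le> r \<longrightarrow> r \<le> \<nu> \<longrightarrow> 0 \<le> t \<longrightarrow> solves_mode \<tau> \<beta> r u v0 v1 v2 \<longrightarrow>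
           cmod (u t) \<le> C * (1 + t) * exp (- ((\<beta> - \<tau>) / 4 * r\<^sup>2 * t)) * (cmod v0 + cmod v1 + cmod v2)"
proof -
  define L where "L = 2 + 1 / (2 * \<beta>) + sqrt (\<beta> / \<tau>) * \<nu>"
  define C where "C = 1 + 2 * \<beta> * (1 + 1 / \<tau>) * L"
  have \<nu>0: "0 < \<nu>" using \<nu> by (simp add: admissible_cutoff_def)
  have \<beta>: "0 < \<beta>" using \<tau> by simp
  have L: "0 \<le> L" using \<tau> \<beta> \<nu>0 by (simp add: L_def)
  have C: "0 < C" using \<beta> \<tau> L by (simp add: C_def add_pos_nonneg)
  have "cmod (u t) \<le> C * (1 + t) * exp (- ((\<beta> - \<tau>) / 4 * r\<^sup>2 * t)) * (cmod v0 + cmod v1 + cmod v2)"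
    if r: "0 \<le> r" "r \<le> \<nu>" and t: "0 \<le> t" and u: "solves_mode \<tau> \<beta> r u v0 v1 v2" for r u v0 v1 v2 t
  proof -
    define S where "S = cmod v0 + cmod v1 + cmod v2"
    have S: "0 \<le> S" by (simp add: S_def)
    obtain b where b: "char_root \<tau> \<beta> r b" using char_root_exists[OF \<tau>] by blast
    note b' = char_root_pos[OF \<tau> b]
    define q where "q = 1 - \<tau> * b"
    define \<kappa> where "\<kappa> = q / (2 * \<tau>)"
    define m where "m = r\<^sup>2 / b"
    define M where "M = m - q * \<kappa> + \<tau> * \<kappa>\<^sup>2"
    have q0: "0 \<le> q" using b' by (simp add: q_def)
    have "(\<beta> * r / 2)\<^sup>2 \<le> (\<beta> * \<nu> / 2)\<^sup>2"
      using r \<beta> by (intro power_mono) (auto simp: mult_left_mono divide_right_mono)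
    then have q: "q \<le> (\<beta> * r / 2)\<^sup>2" "q \<le> (\<beta> * \<nu> / 2)\<^sup>2"
      using char_root_damping_le[OF \<tau> b] by (simp_all add: q_def)
    then have q': "q \<le> (\<beta> - \<tau>) / (2 * \<beta>)" "q \<le> \<tau> / \<beta>" "q \<le> 4 * \<tau>\<^sup>2 / \<beta>\<^sup>2"
      using \<nu> by (auto simp: admissible_cutoff_def)
    have \<kappa>0: "0 \<le> \<kappa>" using q0 \<tau> by (simp add: \<kappa>_def)
    have \<kappa>r: "(\<beta> - \<tau>) / 4 * r\<^sup>2 \<le> \<kappa>"
      using char_root_damping_ge[OF \<tau> b] q'(1) \<tau> by (simp add: q_def \<kappa>_def field_simps)
    have \<kappa>\<beta>: "\<kappa> \<le> 1 / (2 * \<beta>)" using q'(2) \<tau> by (simp add: \<kappa>_def field_simps)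
    have mr: "\<tau> * r\<^sup>2 \<le> m" "m \<le> \<beta> * r\<^sup>2"
      using b' mult_right_mono[of "\<tau> * b" 1 "r\<^sup>2"] mult_right_mono[of 1 "\<beta> * b" "r\<^sup>2"]
      by (auto simp: m_def field_simps)
    have M_eq: "M = m - q\<^sup>2 / (4 * \<tau>)"
      using \<tau> by (simp add: M_def \<kappa>_def power2_eq_square field_simps)
    have "q * q \<le> (\<beta> * r / 2)\<^sup>2 * (4 * \<tau>\<^sup>2 / \<beta>\<^sup>2)"
      using q q' q0 by (intro mult_mono) auto
    then have "q\<^sup>2 \<le> \<tau>\<^sup>2 * r\<^sup>2" using \<beta> by (simp add: power2_eq_square mult_ac)
    also have "\<dots> \<le> (\<tau> * r\<^sup>2) * (4 * \<tau>)" using \<tau> by (simp add: power2_eq_square)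
    finally have "q\<^sup>2 / (4 * \<tau>) \<le> \<tau> * r\<^sup>2"
      using \<tau> by (simp add: pos_divide_le_eq)
    then have M0: "0 \<le> M" using mr by (simp add: M_eq)
    have "0 \<le> q\<^sup>2 / (4 * \<tau>)" using \<tau> by simp
    then have "M \<le> \<beta> * r\<^sup>2" using mr by (simp add: M_eq)
    also have "\<dots> \<le> \<beta> * \<nu>\<^sup>2" using r \<beta> by (intro mult_left_mono power_mono) auto
    finally have "M / \<tau> \<le> \<beta> * \<nu>\<^sup>2 / \<tau>" using \<tau> by (intro divide_right_mono) auto
    then have "sqrt (M / \<tau>) \<le> sqrt (\<beta> / \<tau> * \<nu>\<^sup>2)" by simp
    also have "\<dots> = sqrt (\<beta> / \<tau>) * \<nu>" unfolding real_sqrt_mult using \<nu>0 by simp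
    finally have sM: "sqrt (M / \<tau>) \<le> sqrt (\<beta> / \<tau>) * \<nu>" .
    have "cmod (u t) \<le> (1 + 2 * \<beta> * (1 + 1 / \<tau>) * (L * (1 + t))) * exp (- (\<kappa> * t)) * S"
      unfolding S_def
    proof (rule mode_bound[OF \<tau> b u \<kappa>\<beta> _ t])
      show "0 \<le> L * (1 + t)" using L t by simp
      fix w w' w'' :: "real \<Rightarrow> complex" and A s
      assume s: "0 \<le> s" "s \<le> t" and w:
        "\<And>t. 0 \<le> t \<Longrightarrow> (w has_vector_derivative w' t) (at t within {0..})"
        "\<And>t. 0 \<le> t \<Longrightarrow> (w' has_vector_derivative w'' t) (at t within {0..})"
        "\<And>t. 0 \<le> t \<Longrightarrow> \<tau> *\<^sub>R w'' t + (1 - \<tau> * b) *\<^sub>R w' t + (r\<^sup>2 / b) *\<^sub>R w t = 0"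
        and w0: "cmod (w 0) \<le> A" "cmod (w' 0) \<le> A"
      have A: "0 \<le> A" using w0(1) norm_ge_zero order_trans by blast
      have "exp (\<kappa> * s) * cmod (w s) \<le> cmod (w 0)
          + s * (cmod (w' 0) + \<kappa> * cmod (w 0) + sqrt (M / \<tau>) * cmod (w 0))"
        using \<tau> by (intro damped_oscillator_bounds(2)[OF _ \<kappa>0 _ s(1) M_def M0 w(1,2)])
          (auto simp: \<kappa>_def w(3) q_def m_def)
      also have "\<dots> \<le> A + t * (A + 1 / (2 * \<beta>) * A + sqrt (\<beta> / \<tau>) * \<nu> * A)"
        using w0 s t A sM \<kappa>\<beta> \<kappa>0 M0 \<tau> \<beta> \<nu>0
        by (intro add_mono mult_mono) auto
      also have "\<dots> \<le> L * (1 + t) * A"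
      proof -
        define e where "e = 1 / (2 * \<beta>) + sqrt (\<beta> / \<tau>) * \<nu>"
        have "0 \<le> e" using \<tau> \<beta> \<nu>0 by (simp add: e_def)
        then have "0 \<le> A + A * e + t * A" using A t by simp
        then have "A + t * (A + e * A) \<le> (2 + e) * (1 + t) * A" by (simp add: algebra_simps)
        then show ?thesis by (simp add: e_def L_def algebra_simps)
      qed
      finally show "exp (\<kappa> * s) * cmod (w s) \<le> L * (1 + t) * A" .
    qed
    also have "\<dots> \<le> C * (1 + t) * exp (- ((\<beta> - \<tau>) / 4 * r\<^sup>2 * t)) * S"
    proof (intro mult_right_mono mult_mono)
      show "1 + 2 * \<beta> * (1 + 1 / \<tau>) * (L * (1 + t)) \<le> C * (1 + t)"
        using t by (simp add: C_def algebra_simps)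
      show "exp (- (\<kappa> * t)) \<le> exp (- ((\<beta> - \<tau>) / 4 * r\<^sup>2 * t))"
        using mult_right_mono[OF \<kappa>r t] by simp
    qed (use C t S in auto)
    finally show ?thesis by (simp add: S_def)
  qed
  with C show ?thesis by blast
qed

text \<open>
  The rate \<open>c\<close> is at most half the damping divided by \<open>\<tau>\<close>, at the cutoff and therefore at all
  higher frequencies.  The stiffness after the shift satisfies \<open>M \<ge> \<tau> r\<^sup>2 - q c\<close>.  Since \<open>q\<close> is
  at most \<open>(\<beta> r / 2)\<^sup>2\<close> and \<open>c\<close> at most \<open>2 \<tau> / \<beta>\<^sup>2\<close>, the product \<open>q c\<close> uses up at most half of
  \<open>\<tau> r\<^sup>2\<close>, and \<open>M\<close> stays bounded below by \<open>\<tau> \<nu>\<^sup>2 / 2\<close>.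
\<close>

lemma high_frequency_bound:
  assumes \<tau>: "0 < \<tau>" "\<tau> < \<beta>" and \<nu>: "admissible_cutoff \<tau> \<beta> \<nu>"
    and c: "0 \<le> c" "c \<le> \<bar>Re (lambda2 \<tau> \<beta> \<nu>)\<bar>"
  shows "\<exists>C>0. \<forall>r u v0 v1 v2 t. \<nu> \<le> r \<longrightarrow> 0 \<le> t \<longrightarrow> solves_mode \<tau> \<beta> r u v0 v1 v2 \<longrightarrow>
           cmod (u t) \<le> C * exp (- (c * t)) * (cmod v0 + cmod v1 + cmod v2)"
proof -
  define L where "L = 1 + 2 / \<nu> * (1 + 1 / (2 * \<beta>))"
  define C where "C = 1 + 2 * \<beta> * (1 + 1 / \<tau>) * L"
  have \<nu>0: "0 < \<nu>" using \<nu> by (simp add: admissible_cutoff_def)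
  have \<beta>: "0 < \<beta>" using \<tau> by simp
  have L: "0 \<le> L" using \<tau> \<beta> \<nu>0 by (simp add: L_def)
  have C: "0 < C" using \<beta> \<tau> L by (simp add: C_def add_pos_nonneg)
  obtain a where a: "char_root \<tau> \<beta> \<nu> a" using char_root_exists[OF \<tau>] by blast
  define p where "p = 1 - \<tau> * a"
  have p: "p \<le> 1 / 3" "p \<le> \<tau> / \<beta>" "p \<le> 4 * \<tau>\<^sup>2 / \<beta>\<^sup>2"
    using char_root_damping_le[OF \<tau> a] \<nu> by (auto simp: admissible_cutoff_def p_def)
  have cp: "c \<le> p / (2 * \<tau>)"
    using c Re_lambda2_eq[OF \<tau> \<nu>0 _ a] \<nu> by (simp add: admissible_cutoff_def p_def)
  have c\<beta>: "c \<le> 1 / (2 * \<beta>)"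
    using cp divide_right_mono[OF p(2), of "2 * \<tau>"] \<tau> by simp
  have c2: "c \<le> 2 * \<tau> / \<beta>\<^sup>2"
    using cp divide_right_mono[OF p(3), of "2 * \<tau>"] \<tau> by (simp add: power2_eq_square)
  have "cmod (u t) \<le> C * exp (- (c * t)) * (cmod v0 + cmod v1 + cmod v2)"
    if r: "\<nu> \<le> r" and t: "0 \<le> t" and u: "solves_mode \<tau> \<beta> r u v0 v1 v2" for r u v0 v1 v2 t
  proof -
    obtain b where b: "char_root \<tau> \<beta> r b" using char_root_exists[OF \<tau>] by blast
    note b' = char_root_pos[OF \<tau> b]
    define q where "q = 1 - \<tau> * b"
    define m where "m = r\<^sup>2 / b"
    define M where "M = m - q * c + \<tau> * c\<^sup>2"
    have q0: "0 \<le> q" using b' by (simp add: q_def)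
    have pq: "p \<le> q"
      using char_root_damping_mono[OF \<tau> a _ b _ r] p(1) \<nu>0 by (simp add: p_def q_def)
    have cq: "2 * \<tau> * c \<le> q" using cp pq \<tau> by (simp add: field_simps)
    have "\<tau> * r\<^sup>2 \<le> m"
      using b' mult_right_mono[of "\<tau> * b" 1 "r\<^sup>2"] by (auto simp: m_def field_simps)
    moreover have "q * c \<le> (\<beta> * r / 2)\<^sup>2 * (2 * \<tau> / \<beta>\<^sup>2)"
      using char_root_damping_le[OF \<tau> b] c2 c q0 by (intro mult_mono) (auto simp: q_def)
    then have "q * c \<le> \<tau> * r\<^sup>2 / 2" using \<beta> by (simp add: power2_eq_square mult_ac)
    moreover have "0 \<le> \<tau> * c\<^sup>2" using \<tau> by simp
    moreover have "\<tau> * \<nu>\<^sup>2 \<le> \<tau> * r\<^sup>2" using r \<nu>0 \<tau> by (intro mult_left_mono power_mono) auto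
    ultimately have "\<tau> * \<nu>\<^sup>2 / 2 \<le> M" unfolding M_def by linarith
    moreover have "0 < \<tau> * \<nu>\<^sup>2 / 2" using \<tau> \<nu>0 by simp
    ultimately have M: "\<tau> * \<nu>\<^sup>2 / 2 \<le> M" "0 < M" by linarith+
    have "\<tau> / M \<le> \<tau> / (\<tau> * \<nu>\<^sup>2 / 2)"
      using M \<tau> \<nu>0 by (intro divide_left_mono) auto
    also have "\<dots> \<le> (2 / \<nu>)\<^sup>2" using \<tau> \<nu>0 by (simp add: power2_eq_square field_simps)
    finally have sM: "sqrt (\<tau> / M) \<le> 2 / \<nu>" using \<nu>0 by (intro real_le_lsqrt) auto
    show ?thesis
      unfolding C_def
    proof (rule mode_bound[OF \<tau> b u c\<beta> L t])
      fix w w' w'' :: "real \<Rightarrow> complex" and A s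
      assume s: "0 \<le> s" "s \<le> t" and w:
        "\<And>t. 0 \<le> t \<Longrightarrow> (w has_vector_derivative w' t) (at t within {0..})"
        "\<And>t. 0 \<le> t \<Longrightarrow> (w' has_vector_derivative w'' t) (at t within {0..})"
        "\<And>t. 0 \<le> t \<Longrightarrow> \<tau> *\<^sub>R w'' t + (1 - \<tau> * b) *\<^sub>R w' t + (r\<^sup>2 / b) *\<^sub>R w t = 0"
        and w0: "cmod (w 0) \<le> A" "cmod (w' 0) \<le> A"
      have A: "0 \<le> A" using w0(1) norm_ge_zero order_trans by blast
      have "exp (c * s) * cmod (w s) \<le> cmod (w 0) + sqrt (\<tau> / M) * (cmod (w' 0) + c * cmod (w 0))"
        by (rule damped_oscillator_bounds(1)[OF \<tau>(1) c(1) cq s(1) M_def _ w(1,2)])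
          (use M w(3) in \<open>auto simp: q_def m_def\<close>)
      also have "\<dots> \<le> A + 2 / \<nu> * (A + 1 / (2 * \<beta>) * A)"
        using w0 A sM c\<beta> c M \<tau> \<beta> \<nu>0 by (intro add_mono mult_mono) auto
      finally show "exp (c * s) * cmod (w s) \<le> L * A" by (simp add: L_def algebra_simps)
    qed
  qed
  with C show ?thesis by blast
qed

section \<open>The Fourier transform of integrable functions\<close>

lemma leb_sigma_finite: "sigma_finite_measure (leb N)"
proof -
  interpret finite_product_sigma_finite "\<lambda>_. lborel :: real measure" "{..<N}" by standard auto
  show ?thesis unfolding leb_def by (rule sigma_finite_measure_axioms)
qed

lemma component_measurable: "i < N \<Longrightarrow> (\<lambda>x. x i) \<in> borel_measurable (leb N)"
  unfolding leb_def using measurable_component_singleton[of i "{..<N}" "\<lambda>_. lborel :: real measure"] by simp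

lemma L2_set_measurable [measurable]: "(\<lambda>x. L2_set x {..<N}) \<in> borel_measurable (leb N)"
proof -
  have [measurable]: "(\<lambda>x. \<Sum>i<N. (x i)\<^sup>2) \<in> borel_measurable (leb N)"
    by (rule borel_measurable_sum) (auto intro!: borel_measurable_power component_measurable)
  show ?thesis unfolding L2_set_def by measurable
qed

lemma fourier_integral_measurable:
  assumes [measurable]: "f \<in> borel_measurable (leb N)"
  shows "fourier_integral N f \<in> borel_measurable (leb N)"
proof -
  interpret sigma_finite_measure "leb N" by (rule leb_sigma_finite)
  have [measurable]: "(cis :: real \<Rightarrow> complex) \<in> borel_measurable borel"
    by (intro borel_measurable_continuous_onI continuous_intros)
  have [measurable]: "(\<lambda>z. \<Sum>i<N. snd z i * fst z i) \<in> borel_measurable (leb N \<Otimes>\<^sub>M leb N)"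
    by (rule borel_measurable_sum) 
       (auto intro!: borel_measurable_times component_measurable
          measurable_compose[OF measurable_fst] measurable_compose[OF measurable_snd])
  have "(\<lambda>z. cis (- (\<Sum>i<N. snd z i * fst z i)) * f (snd z)) \<in> borel_measurable (leb N \<Otimes>\<^sub>M leb N)"
    by measurable
  then have [measurable]: "(\<lambda>(\<xi>, x). cis (- (\<Sum>i<N. x i * \<xi> i)) * f x) \<in> borel_measurable (leb N \<Otimes>\<^sub>M leb N)"
    by (simp add: case_prod_beta)
  show ?thesis unfolding fourier_integral_def[abs_def]
    by (intro borel_measurable_times borel_measurable_const borel_measurable_lebesgue_integral) measurable
qed

lemma truncation_measurable:
  assumes [measurable]: "f \<in> borel_measurable (leb N)"
  shows "(\<lambda>x. if L2_set x {..<N} < R then f x else 0) \<in> borel_measurable (leb N)"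
  by measurable

text \<open>
  The constant \<open>(2 \<pi>)\<^sup>-\<^sup>N\<^sup>/\<^sup>2\<close> of the unitary normalisation is at most \<open>1\<close>.
\<close>

lemma norm_fourier_integral_le: "cmod (fourier_integral N f \<xi>) \<le> L1_norm N f"
proof -
  have "(2 * pi) powr (- real N / 2) \<le> (2 * pi) powr 0"
    by (intro powr_mono) (use pi_ge_two in auto)
  then have p: "(2 * pi) powr (- real N / 2) \<le> 1" by (simp split: if_splits)
  have "cmod (\<integral>x. cis (- (\<Sum>i<N. x i * \<xi> i)) * f x \<partial>leb N) \<le> L1_norm N f"
    unfolding L1_norm_def
    by (rule order_trans[OF integral_norm_bound]) (simp add: norm_mult)
  moreover have "0 \<le> L1_norm N f" by (simp add: L1_norm_def)
  ultimately show ?thesis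
    using p mult_mono[OF p, of "cmod (\<integral>x. cis (- (\<Sum>i<N. x i * \<xi> i)) * f x \<partial>leb N)" "L1_norm N f"]
    by (simp add: fourier_integral_def norm_mult)
qed

lemma fourier_integral_truncation_tendsto:
  assumes f: "integrable (leb N) f"
  shows "(\<lambda>n. fourier_integral N (\<lambda>x. if L2_set x {..<N} < real n then f x else 0) \<xi>)
           \<longlonglongrightarrow> fourier_integral N f \<xi>"
proof -
  have [measurable]: "f \<in> borel_measurable (leb N)" using f by simp
  have [measurable]: "(cis :: real \<Rightarrow> complex) \<in> borel_measurable borel"
    by (intro borel_measurable_continuous_onI continuous_intros)
  have [measurable]: "(\<lambda>x. \<Sum>i<N. x i * \<xi> i) \<in> borel_measurable (leb N)"
    by (rule borel_measurable_sum) (auto intro!: borel_measurable_times component_measurable)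
  have "(\<lambda>n. \<integral>x. cis (- (\<Sum>i<N. x i * \<xi> i)) * (if L2_set x {..<N} < real n then f x else 0) \<partial>leb N)
     \<longlonglongrightarrow> (\<integral>x. cis (- (\<Sum>i<N. x i * \<xi> i)) * f x \<partial>leb N)"
  proof (rule integral_dominated_convergence[where w = "\<lambda>x. cmod (f x)"])
    show "AE x in leb N. (\<lambda>n. cis (- (\<Sum>i<N. x i * \<xi> i)) * (if L2_set x {..<N} < real n then f x else 0))
        \<longlonglongrightarrow> cis (- (\<Sum>i<N. x i * \<xi> i)) * f x"
    proof (rule AE_I2, rule tendsto_eventually)
      fix x
      obtain m where m: "L2_set x {..<N} < real m" using reals_Archimedean2 by blast
      show "\<forall>\<^sub>F n in sequentially. cis (- (\<Sum>i<N. x i * \<xi> i)) * (if L2_set x {..<N} < real n then f x else 0)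
          = cis (- (\<Sum>i<N. x i * \<xi> i)) * f x"
        using eventually_ge_at_top[of m] by eventually_elim (use m in auto)
    qed
  qed (use f in \<open>auto simp: norm_mult\<close>)
  then show ?thesis unfolding fourier_integral_def by (intro tendsto_intros)
qed

text \<open>
  For an integrable function the Fourier integrals of the truncations converge at every
  frequency.  By Fatou's lemma the \<open>L\<^sup>2\<close> distance between the pointwise limit and the \<open>L\<^sup>2\<close> limit
  is \<open>0\<close>.
\<close>

lemma L2_fourier_integrable:
  assumes F: "has_L2_fourier N f F" and f: "integrable (leb N) f"
  shows "AE \<xi> in leb N. F \<xi> = fourier_integral N f \<xi>"
proof -
  have fm: "f \<in> borel_measurable (leb N)" using f by simp
  have [measurable]: "F \<in> borel_measurable (leb N)"
    using F by (simp add: has_L2_fourier_def square_integrable_def)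
  note [measurable] = fourier_integral_measurable[OF fm]
    fourier_integral_measurable[OF truncation_measurable[OF fm]]
  define H where "H n \<xi> = ennreal ((cmod (F \<xi> -
      fourier_integral N (\<lambda>x. if L2_set x {..<N} < real n then f x else 0) \<xi>))\<^sup>2)" for n :: nat and \<xi>
  have [measurable]: "H n \<in> borel_measurable (leb N)" for n
    unfolding H_def by measurable
  have lim: "(\<lambda>n. H n \<xi>) \<longlonglongrightarrow> ennreal ((cmod (F \<xi> - fourier_integral N f \<xi>))\<^sup>2)" for \<xi>
    unfolding H_def by (intro tendsto_intros tendsto_ennrealI fourier_integral_truncation_tendsto f)
  have "((\<lambda>n. \<integral>\<^sup>+\<xi>. H n \<xi> \<partial>leb N) \<longlongrightarrow> 0) sequentially"
    using F filterlim_compose[OF _ filterlim_real_sequentially]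
    unfolding has_L2_fourier_def H_def by blast
  then have 0: "liminf (\<lambda>n. \<integral>\<^sup>+\<xi>. H n \<xi> \<partial>leb N) = 0"
    by (intro lim_imp_Liminf) auto
  have "(\<integral>\<^sup>+\<xi>. ennreal ((cmod (F \<xi> - fourier_integral N f \<xi>))\<^sup>2) \<partial>leb N)
      = (\<integral>\<^sup>+\<xi>. liminf (\<lambda>n. H n \<xi>) \<partial>leb N)"
    by (intro nn_integral_cong) (simp add: lim_imp_Liminf[OF _ lim])
  also have "\<dots> \<le> liminf (\<lambda>n. \<integral>\<^sup>+\<xi>. H n \<xi> \<partial>leb N)"
    by (rule nn_integral_liminf) simp
  finally have "(\<integral>\<^sup>+\<xi>. ennreal ((cmod (F \<xi> - fourier_integral N f \<xi>))\<^sup>2) \<partial>leb N) = 0"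
    using 0 by simp
  then show ?thesis by (subst (asm) nn_integral_0_iff_AE) auto
qed

lemma has_L2_fourier_unique:
  assumes F: "has_L2_fourier N f F" and G: "has_L2_fourier N f G"
  shows "AE \<xi> in leb N. F \<xi> = G \<xi>"
proof -
  have fm: "f \<in> borel_measurable (leb N)" and [measurable]: "F \<in> borel_measurable (leb N)" "G \<in> borel_measurable (leb N)"
    using F G by (simp_all add: has_L2_fourier_def square_integrable_def)
  define I where "I R = fourier_integral N (\<lambda>x. if L2_set x {..<N} < R then f x else 0)" for R
  have [measurable]: "I R \<in> borel_measurable (leb N)" for R
    unfolding I_def by (rule fourier_integral_measurable[OF truncation_measurable[OF fm]])
  let ?d = "\<lambda>A R. \<integral>\<^sup>+\<xi>. ennreal ((cmod (A \<xi> - I R \<xi>))\<^sup>2) \<partial>leb N"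
  have "((\<lambda>R. 2 * ?d F R + 2 * ?d G R) \<longlongrightarrow> 2 * 0 + 2 * 0) at_top"
    using F G unfolding has_L2_fourier_def I_def
    by (intro tendsto_add ennreal_tendsto_cmult) auto
  moreover have "(\<integral>\<^sup>+\<xi>. ennreal ((cmod (F \<xi> - G \<xi>))\<^sup>2) \<partial>leb N) \<le> 2 * ?d F R + 2 * ?d G R" for R
  proof -
    have "(\<integral>\<^sup>+\<xi>. ennreal ((cmod (F \<xi> - G \<xi>))\<^sup>2) \<partial>leb N)
       \<le> (\<integral>\<^sup>+\<xi>. 2 * ennreal ((cmod (F \<xi> - I R \<xi>))\<^sup>2) + 2 * ennreal ((cmod (G \<xi> - I R \<xi>))\<^sup>2) \<partial>leb N)"
    proof (rule nn_integral_mono)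
      fix \<xi>
      let ?x = "cmod (F \<xi> - I R \<xi>)" and ?y = "cmod (G \<xi> - I R \<xi>)"
      have "cmod (F \<xi> - G \<xi>) \<le> ?x + ?y"
        using norm_triangle_ineq4[of "F \<xi> - I R \<xi>" "G \<xi> - I R \<xi>"] by simp
      then have "(cmod (F \<xi> - G \<xi>))\<^sup>2 \<le> (?x + ?y)\<^sup>2" by (intro power_mono) auto
      also have "\<dots> \<le> 2 * ?x\<^sup>2 + 2 * ?y\<^sup>2"
        using zero_le_power2[of "?x - ?y"] by (simp add: power2_sum power2_diff)
      finally have "ennreal ((cmod (F \<xi> - G \<xi>))\<^sup>2) \<le> ennreal (2 * ?x\<^sup>2 + 2 * ?y\<^sup>2)" by (rule ennreal_leI)
      then show "ennreal ((cmod (F \<xi> - G \<xi>))\<^sup>2) \<le> 2 * ennreal (?x\<^sup>2) + 2 * ennreal (?y\<^sup>2)"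
        by (simp add: ennreal_mult)
    qed
    also have "\<dots> = 2 * ?d F R + 2 * ?d G R"
      by (subst nn_integral_add) (auto simp: nn_integral_cmult)
    finally show ?thesis .
  qed
  ultimately have "(\<integral>\<^sup>+\<xi>. ennreal ((cmod (F \<xi> - G \<xi>))\<^sup>2) \<partial>leb N) \<le> 0"
    by (intro tendsto_lowerbound[of _ _ at_top]) auto
  then have "(\<integral>\<^sup>+\<xi>. ennreal ((cmod (F \<xi> - G \<xi>))\<^sup>2) \<partial>leb N) = 0" by simp
  then show ?thesis by (subst (asm) nn_integral_0_iff_AE) auto
qed

text \<open>
  The transform \<open>L2_fourier N f\<close> is an arbitrary choice among the \<open>L\<^sup>2\<close> limits; it can be
  replaced by any other of them up to a null set.
\<close>

lemma L2_fourier_eq: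
  assumes "has_L2_fourier N f F"
  shows "AE \<xi> in leb N. L2_fourier N f \<xi> = F \<xi>"
    and "L2_fourier N f \<in> borel_measurable (leb N)"
proof -
  have *: "has_L2_fourier N f (L2_fourier N f)"
    unfolding L2_fourier_def by (rule someI[of "has_L2_fourier N f", OF assms])
  show "AE \<xi> in leb N. L2_fourier N f \<xi> = F \<xi>" by (rule has_L2_fourier_unique[OF * assms])
  show "L2_fourier N f \<in> borel_measurable (leb N)"
    using * by (simp add: has_L2_fourier_def square_integrable_def)
qed

text \<open>
  This removes the choice in \<open>L2_fourier\<close> from the definitions of the norms.
\<close>

lemma deriv_eq_of_AE:
  assumes F: "has_L2_fourier N f F"
    and H[measurable]: "H \<in> borel_measurable (leb N)" and eq: "AE \<xi> in leb N. F \<xi> = H \<xi>"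
  shows "deriv_in_L2 N j f \<longleftrightarrow> integrable (leb N) (\<lambda>\<xi>. L2_set \<xi> {..<N} ^ (2 * j) * (cmod (H \<xi>))\<^sup>2)"
    and "deriv_norm N j f = sqrt (\<integral>\<xi>. L2_set \<xi> {..<N} ^ (2 * j) * (cmod (H \<xi>))\<^sup>2 \<partial>leb N)"
proof -
  have [measurable]: "L2_fourier N f \<in> borel_measurable (leb N)" by (rule L2_fourier_eq(2)[OF F])
  have *: "AE \<xi> in leb N. L2_set \<xi> {..<N} ^ (2 * j) * (cmod (L2_fourier N f \<xi>))\<^sup>2
      = L2_set \<xi> {..<N} ^ (2 * j) * (cmod (H \<xi>))\<^sup>2"
    using L2_fourier_eq(1)[OF F] eq by eventually_elim simp
  show "deriv_in_L2 N j f \<longleftrightarrow> integrable (leb N) (\<lambda>\<xi>. L2_set \<xi> {..<N} ^ (2 * j) * (cmod (H \<xi>))\<^sup>2)"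
    unfolding deriv_in_L2_def by (rule integrable_cong_AE[OF _ _ *]) measurable
  show "deriv_norm N j f = sqrt (\<integral>\<xi>. L2_set \<xi> {..<N} ^ (2 * j) * (cmod (H \<xi>))\<^sup>2 \<partial>leb N)"
    unfolding deriv_norm_def by (rule arg_cong[OF integral_cong_AE[OF _ _ *]]) measurable
qed

text \<open>
  The weight \<open>|\<xi>|\<^sup>2\<^sup>j\<close> is dominated by \<open>(1 + |\<xi>|\<^sup>2)\<^sup>s\<close> because \<open>j \<le> s\<close>.
\<close>

lemma Sobolev_data:
  assumes f: "integrable (leb N) f" and "in_Sobolev N s f" and j: "real j \<le> s"
  shows "integrable (leb N) (\<lambda>\<xi>. L2_set \<xi> {..<N} ^ (2 * j) * (cmod (fourier_integral N f \<xi>))\<^sup>2)"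
    and "(\<integral>\<xi>. L2_set \<xi> {..<N} ^ (2 * j) * (cmod (fourier_integral N f \<xi>))\<^sup>2 \<partial>leb N) = (deriv_norm N j f)\<^sup>2"
proof -
  obtain F where F: "has_L2_fourier N f F" and
    int: "integrable (leb N) (\<lambda>\<xi>. (1 + (L2_set \<xi> {..<N})\<^sup>2) powr s * (cmod (F \<xi>))\<^sup>2)"
    using assms(2) by (auto simp: in_Sobolev_def)
  have fm: "f \<in> borel_measurable (leb N)" using f by simp
  have [measurable]: "F \<in> borel_measurable (leb N)"
    using F by (simp add: has_L2_fourier_def square_integrable_def)
  note [measurable] = fourier_integral_measurable[OF fm]
  note eq = L2_fourier_integrable[OF F f]
  show "integrable (leb N) (\<lambda>\<xi>. L2_set \<xi> {..<N} ^ (2 * j) * (cmod (fourier_integral N f \<xi>))\<^sup>2)"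
  proof (rule Bochner_Integration.integrable_bound[OF int])
    show "AE \<xi> in leb N. norm (L2_set \<xi> {..<N} ^ (2 * j) * (cmod (fourier_integral N f \<xi>))\<^sup>2)
        \<le> norm ((1 + (L2_set \<xi> {..<N})\<^sup>2) powr s * (cmod (F \<xi>))\<^sup>2)"
      using eq
    proof eventually_elim
      case (elim \<xi>)
      have "L2_set \<xi> {..<N} ^ (2 * j) \<le> (1 + (L2_set \<xi> {..<N})\<^sup>2) ^ j"
        unfolding power_mult by (intro power_mono) auto
      also have "\<dots> = (1 + (L2_set \<xi> {..<N})\<^sup>2) powr real j"
        by (rule powr_realpow[symmetric]) (simp add: add_pos_nonneg)
      also have "\<dots> \<le> (1 + (L2_set \<xi> {..<N})\<^sup>2) powr s"
        using j by (intro powr_mono) auto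
      finally show ?case using elim by (simp add: abs_mult mult_right_mono)
    qed
  qed measurable
  show "(\<integral>\<xi>. L2_set \<xi> {..<N} ^ (2 * j) * (cmod (fourier_integral N f \<xi>))\<^sup>2 \<partial>leb N) = (deriv_norm N j f)\<^sup>2"
    using deriv_eq_of_AE(2)[OF F _ eq] by (simp add: L2_set_nonneg)
qed

section \<open>Gaussian moments\<close>

text \<open>
  The Gaussian is a product over the coordinates, and each factor is a multiple of a
  centred normal density.
\<close>

lemma nn_integral_gaussian:
  assumes a: "0 < a"
  shows "(\<integral>\<^sup>+\<xi>. ennreal (exp (- a * (L2_set \<xi> {..<N})\<^sup>2)) \<partial>leb N) = ennreal ((pi / a) powr (real N / 2))"
proof -
  interpret product_sigma_finite "\<lambda>_. lborel :: real measure" by standard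
  have 1: "(\<integral>\<^sup>+x. ennreal (exp (- a * x\<^sup>2)) \<partial>lborel) = ennreal (sqrt (pi / a))"
  proof -
    \<comment> \<open>the standard deviation for which \<open>a = 1 / (2 \<sigma>\<^sup>2)\<close>\<close>
    define \<sigma> where "\<sigma> = sqrt (1 / (2 * a))"
    have \<sigma>: "0 < \<sigma>" "\<sigma>\<^sup>2 = 1 / (2 * a)" using a by (auto simp: \<sigma>_def)
    have "exp (- a * x\<^sup>2) = sqrt (pi / a) * normal_density 0 \<sigma> x" for x
      using a by (simp add: normal_density_def \<sigma> real_sqrt_divide)
    then have "(\<integral>\<^sup>+x. ennreal (exp (- a * x\<^sup>2)) \<partial>lborel)
        = (\<integral>\<^sup>+x. ennreal (sqrt (pi / a)) * ennreal (normal_density 0 \<sigma> x) \<partial>lborel)"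
      using a by (simp add: ennreal_mult)
    also have "\<dots> = ennreal (sqrt (pi / a)) * (\<integral>\<^sup>+x. ennreal (normal_density 0 \<sigma> x) \<partial>lborel)"
      by (rule nn_integral_cmult) measurable
    also have "(\<integral>\<^sup>+x. ennreal (normal_density 0 \<sigma> x) \<partial>lborel) = 1"
      using \<sigma> by (subst nn_integral_eq_integral) auto
    finally show ?thesis by simp
  qed
  have "(\<integral>\<^sup>+\<xi>. ennreal (exp (- a * (L2_set \<xi> {..<N})\<^sup>2)) \<partial>leb N)
      = (\<integral>\<^sup>+\<xi>. (\<Prod>i<N. ennreal (exp (- a * (\<xi> i)\<^sup>2))) \<partial>(\<Pi>\<^sub>M i\<in>{..<N}. lborel))"
    unfolding leb_def L2_set_def
    by (intro nn_integral_cong)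
       (simp add: prod_ennreal sum_nonneg sum_distrib_left flip: exp_sum)
  also have "\<dots> = (\<Prod>i<N. \<integral>\<^sup>+x. ennreal (exp (- a * x\<^sup>2)) \<partial>lborel)"
    by (rule product_nn_integral_prod) auto
  also have "\<dots> = ennreal (sqrt (pi / a) ^ N)"
    unfolding 1 using a by (simp add: ennreal_power)
  also have "sqrt (pi / a) ^ N = (pi / a) powr (real N / 2)"
    using a by (simp add: powr_half_sqrt[symmetric] powr_powr flip: powr_realpow)
  finally show ?thesis .
qed

text \<open>
  The left-hand side is \<open>j!\<close> times a single term of the exponential series.
\<close>

lemma power_le_fact_exp:
  assumes "0 \<le> (x::real)"
  shows "x ^ j \<le> fact j * exp x"
proof -
  have "x ^ j /\<^sub>R fact j \<le> exp x"
    unfolding exp_def using sum_le_suminf[OF summable_exp_generic[of x], of "{j}"] assms by simp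
  then show ?thesis by (simp add: field_simps)
qed

text \<open>
  Half of the Gaussian absorbs the weight, \<open>(a |\<xi>|\<^sup>2)\<^sup>j \<le> j! e\<^sup>x\<close> with \<open>x = a |\<xi>|\<^sup>2\<close>, and the other half
  is integrated.  Scaling is what matters: both sides are of order \<open>a\<^sup>-\<^sup>j\<^sup>-\<^sup>N\<^sup>/\<^sup>2\<close>.
\<close>

lemma gaussian_moment_bound:
  assumes a: "0 < a"
  shows "integrable (leb N) (\<lambda>\<xi>. L2_set \<xi> {..<N} ^ (2 * j) * exp (- 2 * a * (L2_set \<xi> {..<N})\<^sup>2))"
    and "(\<integral>\<xi>. L2_set \<xi> {..<N} ^ (2 * j) * exp (- 2 * a * (L2_set \<xi> {..<N})\<^sup>2) \<partial>leb N)
         \<le> fact j / a ^ j * (pi / a) powr (real N / 2)"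
proof -
  have G: "integrable (leb N) (\<lambda>\<xi>. exp (- a * (L2_set \<xi> {..<N})\<^sup>2))"
    "(\<integral>\<xi>. exp (- a * (L2_set \<xi> {..<N})\<^sup>2) \<partial>leb N) = (pi / a) powr (real N / 2)"
    using nn_integral_gaussian[OF a, of N]
    by (auto intro!: integrableI_nn_integral_finite simp: integral_eq_nn_integral)
  have bound: "L2_set \<xi> {..<N} ^ (2 * j) * exp (- 2 * a * (L2_set \<xi> {..<N})\<^sup>2)
      \<le> fact j / a ^ j * exp (- a * (L2_set \<xi> {..<N})\<^sup>2)" for \<xi>
  proof -
    let ?r = "(L2_set \<xi> {..<N})\<^sup>2"
    have "(a * ?r) ^ j * exp (- 2 * a * ?r) \<le> fact j * exp (a * ?r) * exp (- 2 * a * ?r)"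
      using a power_le_fact_exp[of "a * ?r" j] by (intro mult_right_mono) auto
    also have "\<dots> = fact j * exp (- a * ?r)" by (simp add: mult.assoc flip: exp_add)
    finally show ?thesis using a by (simp add: power_mult_distrib field_simps flip: power_mult)
  qed
  show int: "integrable (leb N) (\<lambda>\<xi>. L2_set \<xi> {..<N} ^ (2 * j) * exp (- 2 * a * (L2_set \<xi> {..<N})\<^sup>2))"
    by (rule Bochner_Integration.integrable_bound[OF integrable_mult_right[OF G(1), of "fact j / a ^ j"]])
       (use bound a in \<open>auto simp: abs_mult\<close>)
  show "(\<integral>\<xi>. L2_set \<xi> {..<N} ^ (2 * j) * exp (- 2 * a * (L2_set \<xi> {..<N})\<^sup>2) \<partial>leb N)
         \<le> fact j / a ^ j * (pi / a) powr (real N / 2)"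
    using integral_mono[OF int integrable_mult_right[OF G(1), of "fact j / a ^ j"] bound] G(2) by simp
qed

section \<open>From modes to norms\<close>

lemma mode_of_solution:
  assumes "is_solution N \<tau> \<beta> u0 u1 u2 u"
  obtains U where "\<And>t. 0 \<le> t \<Longrightarrow> has_L2_fourier N (u t) (U t)"
    and "\<And>\<xi>. \<xi> \<in> space (leb N) \<Longrightarrow> solves_mode \<tau> \<beta> (L2_set \<xi> {..<N}) (\<lambda>t. U t \<xi>)
           (fourier_integral N u0 \<xi>) (fourier_integral N u1 \<xi>) (fourier_integral N u2 \<xi>)"
  using assms unfolding is_solution_def solves_mode_def scaleR_conv_of_real by blast

text \<open>
  Low frequencies contribute the square root of \<open>(1 + t)\<^sup>2\<close> times a Gaussian moment with
  \<open>a = k (1 + t)\<close>, that is of \<open>(1 + t)\<close> to the power \<open>2 - N/2 - j\<close>.  High frequencies keep the weight on the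
  data.  The constant is explicit, because it has to be independent of \<open>t\<close> and of the data.
\<close>

lemma decay_from_mode_bounds:
  fixes N j :: nat and \<nu> k c C1 C2 t :: real
  assumes k: "0 < k" and C: "0 < C1" "0 < C2" and t: "0 \<le> t" and j: "real j \<le> s"
    and data: "integrable (leb N) u0" "in_Sobolev N s u0" "integrable (leb N) u1" "in_Sobolev N s u1"
      "integrable (leb N) u2" "in_Sobolev N s u2"
    and U: "has_L2_fourier N v U"
    and low: "\<And>\<xi>. \<xi> \<in> space (leb N) \<Longrightarrow> L2_set \<xi> {..<N} \<le> \<nu> \<Longrightarrow>
      cmod (U \<xi>) \<le> C1 * (1 + t) * exp (- (k * (L2_set \<xi> {..<N})\<^sup>2 * t))
        * (cmod (fourier_integral N u0 \<xi>) + cmod (fourier_integral N u1 \<xi>) + cmod (fourier_integral N u2 \<xi>))"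
    and high: "\<And>\<xi>. \<xi> \<in> space (leb N) \<Longrightarrow> \<nu> \<le> L2_set \<xi> {..<N} \<Longrightarrow>
      cmod (U \<xi>) \<le> C2 * exp (- (c * t))
        * (cmod (fourier_integral N u0 \<xi>) + cmod (fourier_integral N u1 \<xi>) + cmod (fourier_integral N u2 \<xi>))"
  shows "deriv_in_L2 N j v"
    and "deriv_norm N j v
      \<le> C1 * exp (k * \<nu>\<^sup>2) * sqrt (fact j / k ^ j * (pi / k) powr (real N / 2))
           * (L1_norm N u0 + L1_norm N u1 + L1_norm N u2) * (1 + t) powr (1 - real N / 4 - real j / 2)
        + 2 * C2 * (deriv_norm N j u0 + deriv_norm N j u1 + deriv_norm N j u2) * exp (- c * t)"
proof -
  define r where "r \<xi> = L2_set \<xi> {..<N}" for \<xi>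
  have r0: "0 \<le> r \<xi>" for \<xi> by (simp add: r_def L2_set_nonneg)
  have [measurable]: "r \<in> borel_measurable (leb N)" unfolding r_def by measurable
  have [measurable]: "U \<in> borel_measurable (leb N)"
    using U by (simp add: has_L2_fourier_def square_integrable_def)
  define f0 f1 f2 where "f0 = fourier_integral N u0" and "f1 = fourier_integral N u1"
    and "f2 = fourier_integral N u2"
  define S where "S \<xi> = cmod (f0 \<xi>) + cmod (f1 \<xi>) + cmod (f2 \<xi>)" for \<xi>
  define A where "A = L1_norm N u0 + L1_norm N u1 + L1_norm N u2"
  define D where "D = deriv_norm N j u0 + deriv_norm N j u1 + deriv_norm N j u2"
  have S: "0 \<le> S \<xi>" "S \<xi> \<le> A" "(S \<xi>)\<^sup>2 \<le> 3 * ((cmod (f0 \<xi>))\<^sup>2 + (cmod (f1 \<xi>))\<^sup>2 + (cmod (f2 \<xi>))\<^sup>2)" for \<xi>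
  proof -
    show "0 \<le> S \<xi>" by (simp add: S_def)
    show "S \<xi> \<le> A" unfolding S_def A_def f0_def f1_def f2_def
      by (intro add_mono norm_fourier_integral_le)
    have "(x + y + z)\<^sup>2 \<le> 3 * (x\<^sup>2 + y\<^sup>2 + z\<^sup>2)" for x y z :: real
      using zero_le_power2[of "x - y"] zero_le_power2[of "x - z"] zero_le_power2[of "y - z"]
      by (simp add: power2_eq_square algebra_simps)
    then show "(S \<xi>)\<^sup>2 \<le> 3 * ((cmod (f0 \<xi>))\<^sup>2 + (cmod (f1 \<xi>))\<^sup>2 + (cmod (f2 \<xi>))\<^sup>2)"
      by (simp add: S_def)
  qed
  have A: "0 \<le> A" by (simp add: A_def L1_norm_def)
  have D: "0 \<le> D" by (simp add: D_def deriv_norm_def)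
  define a where "a = k * (1 + t)"
  have a: "0 < a" using k t by (simp add: a_def)
  \<comment> \<open>\<open>G1\<close> and \<open>G2\<close> dominate the integrand at low and high frequencies.\<close>
  define P where "P = (C1 * (1 + t) * exp (k * \<nu>\<^sup>2) * A)\<^sup>2"
  define Q where "Q = 3 * (C2 * exp (- (c * t)))\<^sup>2"
  define G1 where "G1 \<xi> = P * (r \<xi> ^ (2 * j) * exp (- 2 * a * (r \<xi>)\<^sup>2))" for \<xi>
  define G2 where "G2 \<xi> = Q * (r \<xi> ^ (2 * j) * (cmod (f0 \<xi>))\<^sup>2 + r \<xi> ^ (2 * j) * (cmod (f1 \<xi>))\<^sup>2
      + r \<xi> ^ (2 * j) * (cmod (f2 \<xi>))\<^sup>2)" for \<xi>
  have G0: "0 \<le> G1 \<xi>" "0 \<le> G2 \<xi>" for \<xi>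
    using r0 by (auto simp: G1_def G2_def P_def Q_def)
  have bound: "r \<xi> ^ (2 * j) * (cmod (U \<xi>))\<^sup>2 \<le> G1 \<xi> + G2 \<xi>" if \<xi>: "\<xi> \<in> space (leb N)" for \<xi>
  proof (cases "r \<xi> \<le> \<nu>")
    case True
    have "cmod (U \<xi>) \<le> C1 * (1 + t) * exp (- (k * (r \<xi>)\<^sup>2 * t)) * S \<xi>"
      using low[OF \<xi>] True by (simp add: r_def S_def f0_def f1_def f2_def)
    also have "\<dots> \<le> C1 * (1 + t) * (exp (k * \<nu>\<^sup>2) * exp (- a * (r \<xi>)\<^sup>2)) * A"
    proof (intro mult_mono mult_left_mono S)
      \<comment> \<open>The factor \<open>e\<^sup>x\<close>, \<open>x = k \<nu>\<^sup>2\<close>, pays for replacing \<open>t\<close> by \<open>1 + t\<close> in the Gaussian, which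
        makes the moment finite also at \<open>t = 0\<close>.\<close>
      have "k * (r \<xi>)\<^sup>2 \<le> k * \<nu>\<^sup>2" using True r0 k by (intro mult_left_mono power_mono) auto
      then show "exp (- (k * (r \<xi>)\<^sup>2 * t)) \<le> exp (k * \<nu>\<^sup>2) * exp (- a * (r \<xi>)\<^sup>2)"
        by (simp add: a_def algebra_simps flip: exp_add)
    qed (use C t S in auto)
    also have "\<dots> = C1 * (1 + t) * exp (k * \<nu>\<^sup>2) * A * exp (- a * (r \<xi>)\<^sup>2)" by (simp only: mult_ac)
    finally have "(cmod (U \<xi>))\<^sup>2 \<le> (C1 * (1 + t) * exp (k * \<nu>\<^sup>2) * A * exp (- a * (r \<xi>)\<^sup>2))\<^sup>2"
      by (intro power_mono) auto
    also have "\<dots> = P * exp (- 2 * a * (r \<xi>)\<^sup>2)"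
      unfolding P_def power_mult_distrib[of _ "exp (- a * (r \<xi>)\<^sup>2)"] by (simp flip: exp_double)
    finally have "r \<xi> ^ (2 * j) * (cmod (U \<xi>))\<^sup>2 \<le> r \<xi> ^ (2 * j) * (P * exp (- 2 * a * (r \<xi>)\<^sup>2))"
      using r0 by (intro mult_left_mono) auto
    also have "\<dots> = G1 \<xi>" by (simp only: G1_def mult_ac)
    finally show ?thesis using G0(2)[of \<xi>] by linarith
  next
    case False
    then have "cmod (U \<xi>) \<le> C2 * exp (- (c * t)) * S \<xi>"
      using high[OF \<xi>] by (simp add: r_def S_def f0_def f1_def f2_def)
    then have "(cmod (U \<xi>))\<^sup>2 \<le> (C2 * exp (- (c * t)) * S \<xi>)\<^sup>2"
      by (intro power_mono) auto
    also have "\<dots> = (C2 * exp (- (c * t)))\<^sup>2 * (S \<xi>)\<^sup>2" by (rule power_mult_distrib)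
    also have "\<dots> \<le> (C2 * exp (- (c * t)))\<^sup>2 * (3 * ((cmod (f0 \<xi>))\<^sup>2 + (cmod (f1 \<xi>))\<^sup>2 + (cmod (f2 \<xi>))\<^sup>2))"
      using S by (intro mult_left_mono) auto
    finally have "r \<xi> ^ (2 * j) * (cmod (U \<xi>))\<^sup>2 \<le> r \<xi> ^ (2 * j) *
        ((C2 * exp (- (c * t)))\<^sup>2 * (3 * ((cmod (f0 \<xi>))\<^sup>2 + (cmod (f1 \<xi>))\<^sup>2 + (cmod (f2 \<xi>))\<^sup>2)))"
      using r0 by (intro mult_left_mono) auto
    also have "\<dots> = G2 \<xi>" by (simp add: G2_def Q_def algebra_simps)
    finally show ?thesis using G0(1)[of \<xi>] by linarith
  qed
  note d0 = Sobolev_data[OF data(1,2) j, folded r_def f0_def]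
    and d1 = Sobolev_data[OF data(3,4) j, folded r_def f1_def]
    and d2 = Sobolev_data[OF data(5,6) j, folded r_def f2_def]
  have I1: "integrable (leb N) G1"
    unfolding G1_def r_def by (intro integrable_mult_right gaussian_moment_bound(1) a)
  have I2: "integrable (leb N) G2"
    unfolding G2_def by (intro integrable_mult_right Bochner_Integration.integrable_add d0 d1 d2)
  have I: "integrable (leb N) (\<lambda>\<xi>. r \<xi> ^ (2 * j) * (cmod (U \<xi>))\<^sup>2)"
  proof (rule Bochner_Integration.integrable_bound[OF Bochner_Integration.integrable_add[OF I1 I2]])
    show "AE \<xi> in leb N. norm (r \<xi> ^ (2 * j) * (cmod (U \<xi>))\<^sup>2) \<le> norm (G1 \<xi> + G2 \<xi>)"
      using bound G0 r0 by (intro AE_I2) (simp add: abs_mult)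
  qed measurable
  have UU: "AE \<xi> in leb N. U \<xi> = U \<xi>" by simp
  show "deriv_in_L2 N j v"
    using deriv_eq_of_AE(1)[OF U _ UU] I by (simp add: r_def)
  have "(\<integral>\<xi>. G1 \<xi> \<partial>leb N) \<le> P * (fact j / a ^ j * (pi / a) powr (real N / 2))"
    unfolding G1_def r_def integral_mult_right_zero
    by (intro mult_left_mono gaussian_moment_bound(2) a) (simp add: P_def)
  also have "fact j / a ^ j * (pi / a) powr (real N / 2)
      = fact j / k ^ j * (pi / k) powr (real N / 2) * (1 + t) powr (- real N / 2 - real j)"
  proof -
    have "(pi / a) powr (real N / 2) = (pi / k) powr (real N / 2) * (1 + t) powr (- real N / 2)"
    proof -
      have "pi / a = pi / k / (1 + t)" by (simp add: a_def)
      then have "(pi / a) powr (real N / 2) = (pi / k) powr (real N / 2) / (1 + t) powr (real N / 2)"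
        by (simp only: powr_divide)
      moreover have "(1 + t) powr (- real N / 2) = 1 / (1 + t) powr (real N / 2)"
        using powr_minus_divide[of "1 + t" "real N / 2"] by simp
      ultimately show ?thesis by simp
    qed
    moreover have "(1 + t) powr (- real j) = 1 / (1 + t) ^ j"
      using t by (simp add: powr_minus_divide powr_realpow)
    then have "1 / a ^ j = 1 / k ^ j * (1 + t) powr (- real j)"
      unfolding a_def power_mult_distrib by simp
    moreover have "(1 + t) powr (- real N / 2 - real j) = (1 + t) powr (- real N / 2) * (1 + t) powr (- real j)"
      by (simp flip: powr_add)
    ultimately show ?thesis
      unfolding divide_inverse by (simp add: mult_ac)
  qed
  also have "P * \<dots> = (C1 * exp (k * \<nu>\<^sup>2) * sqrt (fact j / k ^ j * (pi / k) powr (real N / 2))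
      * A * (1 + t) powr (1 - real N / 4 - real j / 2))\<^sup>2"
  proof -
    have "((1 + t) powr (1 - real N / 4 - real j / 2))\<^sup>2 = (1 + t) powr (2 + (- real N / 2 - real j))"
      using t by (simp add: power2_eq_square flip: powr_add)
    also have "\<dots> = (1 + t)\<^sup>2 * (1 + t) powr (- real N / 2 - real j)"
      using t by (simp only: powr_add) simp
    finally show ?thesis using k by (simp add: P_def power_mult_distrib mult_ac)
  qed
  finally have G1: "sqrt (\<integral>\<xi>. G1 \<xi> \<partial>leb N) \<le> C1 * exp (k * \<nu>\<^sup>2)
      * sqrt (fact j / k ^ j * (pi / k) powr (real N / 2)) * A * (1 + t) powr (1 - real N / 4 - real j / 2)"
    using C A k by (intro real_le_lsqrt) auto
  have "(\<integral>\<xi>. G2 \<xi> \<partial>leb N) = Q * ((deriv_norm N j u0)\<^sup>2 + (deriv_norm N j u1)\<^sup>2 + (deriv_norm N j u2)\<^sup>2)"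
    unfolding G2_def by (simp add: d0 d1 d2)
  also have "\<dots> \<le> Q * D\<^sup>2"
  proof (rule mult_left_mono)
    have "0 \<le> deriv_norm N j f" for f by (simp add: deriv_norm_def)
    then show "(deriv_norm N j u0)\<^sup>2 + (deriv_norm N j u1)\<^sup>2 + (deriv_norm N j u2)\<^sup>2 \<le> D\<^sup>2"
      by (simp add: D_def power2_eq_square algebra_simps)
  qed (simp add: Q_def)
  also have "\<dots> \<le> (2 * C2 * D * exp (- c * t))\<^sup>2"
    by (simp add: Q_def power_mult_distrib mult_ac)
  finally have G2: "sqrt (\<integral>\<xi>. G2 \<xi> \<partial>leb N) \<le> 2 * C2 * D * exp (- c * t)"
    using C D by (intro real_le_lsqrt) auto
  have "deriv_norm N j v = sqrt (\<integral>\<xi>. r \<xi> ^ (2 * j) * (cmod (U \<xi>))\<^sup>2 \<partial>leb N)"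
    using deriv_eq_of_AE(2)[OF U _ UU] by (simp add: r_def)
  also have "\<dots> \<le> sqrt (\<integral>\<xi>. G1 \<xi> + G2 \<xi> \<partial>leb N)"
    using I I1 I2 bound by (intro real_sqrt_le_mono integral_mono) auto
  also have "\<dots> = sqrt ((\<integral>\<xi>. G1 \<xi> \<partial>leb N) + (\<integral>\<xi>. G2 \<xi> \<partial>leb N))" using I1 I2 by simp
  also have "\<dots> \<le> sqrt (\<integral>\<xi>. G1 \<xi> \<partial>leb N) + sqrt (\<integral>\<xi>. G2 \<xi> \<partial>leb N)"
    by (rule sqrt_add_le_add_sqrt) (use G0 in \<open>auto intro!: integral_nonneg\<close>)
  finally show "deriv_norm N j v
      \<le> C1 * exp (k * \<nu>\<^sup>2) * sqrt (fact j / k ^ j * (pi / k) powr (real N / 2))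
           * (L1_norm N u0 + L1_norm N u1 + L1_norm N u2) * (1 + t) powr (1 - real N / 4 - real j / 2)
        + 2 * C2 * (deriv_norm N j u0 + deriv_norm N j u1 + deriv_norm N j u2) * exp (- c * t)"
    using G1 G2 unfolding A_def D_def by linarith
qed

theorem theorem4p1:
  fixes \<tau> \<beta> :: real
  assumes "0 < \<tau>" and "\<tau> < \<beta>"
  shows "\<exists>\<nu>0>0. \<forall>\<nu>1 c. 0 < \<nu>1 \<longrightarrow> \<nu>1 < \<nu>0 \<longrightarrow>
    c = Min {1 / \<beta>, (\<beta> - \<tau>) / (2 * \<beta> * \<tau>), \<bar>Re (lambda2 \<tau> \<beta> \<nu>1)\<bar>} \<longrightarrow>
    0 < c \<and>
    (\<forall>N::nat. \<forall>s::real. 1 \<le> N \<longrightarrow> 1 \<le> s \<longrightarrow>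
      (\<exists>C>0. \<forall>u0 u1 u2 u.
        integrable (leb N) u0 \<longrightarrow> in_Sobolev N s u0 \<longrightarrow>
        integrable (leb N) u1 \<longrightarrow> in_Sobolev N s u1 \<longrightarrow>
        integrable (leb N) u2 \<longrightarrow> in_Sobolev N s u2 \<longrightarrow>
        is_solution N \<tau> \<beta> u0 u1 u2 u \<longrightarrow>
        (\<forall>j::nat. \<forall>t\<ge>0. real j \<le> s \<longrightarrow>
          deriv_in_L2 N j (u t) \<and>
          deriv_norm N j (u t)
            \<le> C * (L1_norm N u0 + L1_norm N u1 + L1_norm N u2)
                 * (1 + t) powr (1 - real N / 4 - real j / 2)
              + C * (deriv_norm N j u0 + deriv_norm N j u1 + deriv_norm N j u2)
                 * exp (- c * t))))"
proof -
  obtain \<nu>0 where \<nu>0: "0 < \<nu>0" "\<And>\<nu>. 0 < \<nu> \<Longrightarrow> \<nu> < \<nu>0 \<Longrightarrow> admissible_cutoff \<tau> \<beta> \<nu>"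
    using admissible_cutoff_small[OF assms] by blast
  show ?thesis
  proof (rule exI[of _ \<nu>0], intro conjI allI impI)
    fix \<nu> c :: real
    assume "0 < \<nu>" "\<nu> < \<nu>0"
      and c: "c = Min {1 / \<beta>, (\<beta> - \<tau>) / (2 * \<beta> * \<tau>), \<bar>Re (lambda2 \<tau> \<beta> \<nu>)\<bar>}"
    then have \<nu>: "admissible_cutoff \<tau> \<beta> \<nu>" using \<nu>0 by simp
    have "Re (lambda2 \<tau> \<beta> \<nu>) < 0"
      using \<nu> by (intro lambda2_well_defined assms) (auto simp: admissible_cutoff_def)
    then show c0: "0 < c" using assms by (simp add: c)
    have c_le: "c \<le> \<bar>Re (lambda2 \<tau> \<beta> \<nu>)\<bar>" unfolding c by (rule Min_le) auto
    define k where "k = (\<beta> - \<tau>) / 4"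
    have k: "0 < k" using assms by (simp add: k_def)
    fix N :: nat and s :: real
    obtain C1 where C1: "0 < C1" and low: "\<And>r u v0 v1 v2 t. 0 \<le> r \<Longrightarrow> r \<le> \<nu> \<Longrightarrow> 0 \<le> t \<Longrightarrow>
        solves_mode \<tau> \<beta> r u v0 v1 v2 \<Longrightarrow>
        cmod (u t) \<le> C1 * (1 + t) * exp (- (k * r\<^sup>2 * t)) * (cmod v0 + cmod v1 + cmod v2)"
      using low_frequency_bound[OF assms \<nu>] unfolding k_def by blast
    obtain C2 where C2: "0 < C2" and high: "\<And>r u v0 v1 v2 t. \<nu> \<le> r \<Longrightarrow> 0 \<le> t \<Longrightarrow>
        solves_mode \<tau> \<beta> r u v0 v1 v2 \<Longrightarrow>
        cmod (u t) \<le> C2 * exp (- (c * t)) * (cmod v0 + cmod v1 + cmod v2)"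
      using high_frequency_bound[OF assms \<nu> less_imp_le[OF c0] c_le] by blast
    define B where "B j = sqrt (fact j / k ^ j * (pi / k) powr (real N / 2))" for j
    have B: "0 \<le> B j" for j using k by (simp add: B_def)
    \<comment> \<open>The constant at low frequencies depends on \<open>j\<close>; the sum over the finitely many \<open>j \<le> s\<close>
      makes it uniform.\<close>
    define C where "C = C1 * exp (k * \<nu>\<^sup>2) * (\<Sum>j\<le>nat \<lfloor>s\<rfloor>. B j) + 2 * C2"
    have C: "0 < C" using C1 C2 B by (simp add: C_def add_nonneg_pos sum_nonneg)
    have "deriv_in_L2 N j (u t) \<and> deriv_norm N j (u t)
        \<le> C * (L1_norm N u0 + L1_norm N u1 + L1_norm N u2) * (1 + t) powr (1 - real N / 4 - real j / 2)
          + C * (deriv_norm N j u0 + deriv_norm N j u1 + deriv_norm N j u2) * exp (- c * t)"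
      if data: "integrable (leb N) u0" "in_Sobolev N s u0" "integrable (leb N) u1" "in_Sobolev N s u1"
          "integrable (leb N) u2" "in_Sobolev N s u2"
        and sol: "is_solution N \<tau> \<beta> u0 u1 u2 u" and t: "0 \<le> t" and j: "real j \<le> s"
      for u0 u1 u2 u j t
    proof -
      obtain U where U: "\<And>t. 0 \<le> t \<Longrightarrow> has_L2_fourier N (u t) (U t)"
        "\<And>\<xi>. \<xi> \<in> space (leb N) \<Longrightarrow> solves_mode \<tau> \<beta> (L2_set \<xi> {..<N}) (\<lambda>t. U t \<xi>)
           (fourier_integral N u0 \<xi>) (fourier_integral N u1 \<xi>) (fourier_integral N u2 \<xi>)"
        using mode_of_solution[OF sol] by blast
      note decay = decay_from_mode_bounds[OF k C1 C2 t j data U(1)[OF t],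
          OF low[OF L2_set_nonneg _ t U(2)] high[OF _ t U(2)]]
      have "deriv_in_L2 N j (u t)" by (rule decay)
      have "j \<le> nat \<lfloor>s\<rfloor>" using j by (simp add: le_nat_iff le_floor_iff)
      then have "B j \<le> (\<Sum>j\<le>nat \<lfloor>s\<rfloor>. B j)"
        using B by (intro member_le_sum) auto
      then have "C1 * exp (k * \<nu>\<^sup>2) * B j \<le> C1 * exp (k * \<nu>\<^sup>2) * (\<Sum>j\<le>nat \<lfloor>s\<rfloor>. B j)"
        using C1 by (intro mult_left_mono) auto
      then have C': "C1 * exp (k * \<nu>\<^sup>2) * B j \<le> C" using C2 by (simp add: C_def)
      have C'': "2 * C2 \<le> C" using C1 B by (simp add: C_def sum_nonneg)
      have "deriv_norm N j (u t)
        \<le> C1 * exp (k * \<nu>\<^sup>2) * B j * (L1_norm N u0 + L1_norm N u1 + L1_norm N u2)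
             * (1 + t) powr (1 - real N / 4 - real j / 2)
          + 2 * C2 * (deriv_norm N j u0 + deriv_norm N j u1 + deriv_norm N j u2) * exp (- c * t)"
        unfolding B_def by (rule decay)
      also have "\<dots> \<le> C * (L1_norm N u0 + L1_norm N u1 + L1_norm N u2)
             * (1 + t) powr (1 - real N / 4 - real j / 2)
          + C * (deriv_norm N j u0 + deriv_norm N j u1 + deriv_norm N j u2) * exp (- c * t)"
        using C' C'' by (intro add_mono mult_right_mono) (auto simp: L1_norm_def deriv_norm_def)
      finally show ?thesis using \<open>deriv_in_L2 N j (u t)\<close> by blast
    qed
    with C show "\<exists>C>0. \<forall>u0 u1 u2 u.
        integrable (leb N) u0 \<longrightarrow> in_Sobolev N s u0 \<longrightarrow>
        integrable (leb N) u1 \<longrightarrow> in_Sobolev N s u1 \<longrightarrow>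
        integrable (leb N) u2 \<longrightarrow> in_Sobolev N s u2 \<longrightarrow>
        is_solution N \<tau> \<beta> u0 u1 u2 u \<longrightarrow>
        (\<forall>j::nat. \<forall>t\<ge>0. real j \<le> s \<longrightarrow>
          deriv_in_L2 N j (u t) \<and>
          deriv_norm N j (u t)
            \<le> C * (L1_norm N u0 + L1_norm N u1 + L1_norm N u2)
                 * (1 + t) powr (1 - real N / 4 - real j / 2)
              + C * (deriv_norm N j u0 + deriv_norm N j u1 + deriv_norm N j u2)
                 * exp (- c * t))"
      by blast
  qed (rule \<nu>0)
qed

end
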